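(* Let $X$ be a linear topological $\aleph_0$-space and $\mathcal S$ be a family of compact subsets of $X$ with union $\bigcup\mathcal S$ dense in $X$. For any linear topological $\aleph$-space $Y$ the operator space $\mathcal L_{\mathcal S}(X,Y)$ endowed with the $\mathcal S$-topology is $k^*$-metrizable provided the evaluation operator $$e:\mathcal L_{\mathcal S}(X,Y)\times X\to Y,\quad e:(T,x)\mapsto T(x)$$ is sequentially continuous.
   Context: All topological spaces are Hausdorff; "map" means continuous function. A linear topological $\aleph_0$-space (resp. $\aleph$-space) is a (real) topological vector space whose underlying topological space is an $\aleph_0$-space (resp. $\aleph$-space). A $k$-network for a space is a family $\mathcal N$ of subsets such that for every open $U$ and compact $K\subset U$ there is a finite $\mathcal F\subset\mathcal N$ with $K\subset\bigcup\mathcal F\subset U$. An $\aleph_0$-space is a regular space with a countable $k$-network; an $\aleph$-space is a regular space with a $\sigma$-locally-finite $k$-network. $\mathcal L(X,Y)$ is the linear space of all continuous linear operators from $X$ to $Y$; the $\mathcal S$-topology (uniform convergence on elements of $\mathcal S$) is the linear topology whose base at the origin consists of the sets $\{L\in\mathcal L(X,Y):L(S_1\cup\dots\cup S_n)\subset U\}$, where $S_1,\dots,S_n\in\mathcal S$ and $U$ is an open neighborhood of the origin in $Y$. $\mathcal L_{\mathcal S}(X,Y)$ is $\mathcal L(X,Y)$ with this topology. A subset is precompact if its closure is compact. A map $f:M\to Z$ is subproper if there is $D\subset M$ with $f(D)=Z$ such that $D\cap f^{-1}(K)$ is precompact in $M$ for every precompact $K\subset Z$. A space is $k^*$-metrizable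 if it is the image of a metrizable space under a subproper map. A function is sequentially continuous if it sends convergent sequences to convergent sequences. *)

theory Defs
  imports "HOL-Analysis.Analysis"
begin

definition k_network :: "'a topology \<Rightarrow> 'a set set \<Rightarrow> bool" where
  "k_network X \<N> \<longleftrightarrow>
     (\<forall>N\<in>\<N>. N \<subseteq> topspace X) \<and>
     (\<forall>U K. openin X U \<and> compactin X K \<and> K \<subseteq> U \<longrightarrow>
        (\<exists>\<F>. finite \<F> \<and> \<F> \<subseteq> \<N> \<and> K \<subseteq> \<Union>\<F> \<and> \<Union>\<F> \<subseteq> U))"

definition sigma_locally_finite_in :: "'a topology \<Rightarrow> 'a set set \<Rightarrow> bool" where
  "sigma_locally_finite_in X \<N> \<longleftrightarrow>
     (\<exists>\<A> :: nat \<Rightarrow> 'a set set. \<N> = (\<Union>n. \<A> n) \<and> (\<forall>n. locally_finite_in X (\<A> n)))"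

text \<open>The constant \<^const>\<open>regular_space\<close> does not include any separation of points, and all
  spaces are meant to be Hausdorff; hence the additional conjunct here and below.\<close>

definition aleph0_space :: "'a topology \<Rightarrow> bool" where
  "aleph0_space X \<longleftrightarrow> Hausdorff_space X \<and> regular_space X \<and> (\<exists>\<N>. countable \<N> \<and> k_network X \<N>)"

definition aleph_space :: "'a topology \<Rightarrow> bool" where
  "aleph_space X \<longleftrightarrow>
     Hausdorff_space X \<and> regular_space X \<and> (\<exists>\<N>. sigma_locally_finite_in X \<N> \<and> k_network X \<N>)"

definition precompact_in :: "'a topology \<Rightarrow> 'a set \<Rightarrow> bool" where
  "precompact_in X A \<longleftrightarrow> A \<subseteq> topspace X \<and> compactin X (X closure_of A)"

definition subproper_map :: "'a topology \<Rightarrow> 'b topology \<Rightarrow> ('a \<Rightarrow> 'b) \<Rightarrow> bool" where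
  "subproper_map M Z f \<longleftrightarrow>
     continuous_map M Z f \<and>
     (\<exists>D \<subseteq> topspace M. f ` D = topspace Z \<and>
        (\<forall>K. precompact_in Z K \<longrightarrow> precompact_in M (D \<inter> f -` K)))"

text \<open>HOL cannot quantify over the type carrying the metrizable space \<open>M\<close>. Taking the points
  of \<open>M\<close> from the type of sequences in \<open>Z\<close> loses nothing: the lemma
  \<open>k_star_metrizableI\<close> below admits a metrizable \<open>M\<close> over an arbitrary type.\<close>

definition k_star_metrizable :: "'a topology \<Rightarrow> bool" where
  "k_star_metrizable Z \<longleftrightarrow>
     Hausdorff_space Z \<and>
     (\<exists>(M :: (nat \<Rightarrow> 'a) topology) f. metrizable_space M \<and> subproper_map M Z f)"

lemma k_star_metrizableI:
  fixes M :: "'m topology" and Z :: "'a topology"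
  assumes Z: "Hausdorff_space Z" and M: "metrizable_space M" and f: "subproper_map M Z f"
  shows "k_star_metrizable Z"
proof -
  obtain D where cf: "continuous_map M Z f" and D: "D \<subseteq> topspace M" "f ` D = topspace Z"
    and pc: "\<And>K. precompact_in Z K \<Longrightarrow> precompact_in M (D \<inter> f -` K)"
    using f unfolding subproper_map_def by auto
  have "\<forall>z\<in>topspace Z. \<exists>x\<in>D. f x = z" using D by (metis image_iff)
  then obtain g where g: "\<And>z. z \<in> topspace Z \<Longrightarrow> g z \<in> D \<and> f (g z) = z" by metis
  define E where "E = g ` topspace Z"
  have ED: "E \<subseteq> D" using g by (auto simp: E_def)
  define C where "C = M closure_of E"
  have EC: "E \<subseteq> C" unfolding C_def using ED D by (intro closure_of_subset) auto
  have CM: "C \<subseteq> topspace M" by (simp add: C_def closure_of_subset_topspace)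
  have C: "closedin M C" by (simp add: C_def)
  have HM: "Hausdorff_space M" using M metrizable_imp_Hausdorff_space by blast
  have "\<exists>\<sigma>. limitin M (g \<circ> \<sigma>) p sequentially" if p: "p \<in> C" for p
  proof -
    obtain S d where "Metric_space S d" and eq: "M = Metric_space.mtopology S d"
      using M by (auto simp: metrizable_space_def)
    then interpret Metric_space S d by simp
    obtain \<tau> where \<tau>: "range \<tau> \<subseteq> E" "limitin M \<tau> p sequentially"
      using p unfolding C_def eq closure_of_sequentially by auto
    have "\<forall>n. \<exists>z. \<tau> n = g z" using \<tau>(1) by (auto simp: E_def)
    then obtain \<sigma> where "\<And>n. \<tau> n = g (\<sigma> n)" by metis
    then have "\<tau> = g \<circ> \<sigma>" by auto
    with \<tau> show ?thesis by blast
  qed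
  then obtain h where h: "\<And>p. p \<in> C \<Longrightarrow> limitin M (g \<circ> h p) p sequentially" by metis
  have inj: "inj_on h C"
    by (rule inj_onI) (metis h limitin_Hausdorff_unique HM trivial_limit_sequentially)
  define k where "k = inv_into C h"
  have kh: "k (h p) = p" if "p \<in> C" for p using that inj by (simp add: k_def)
  define N where "N = pullback_topology (h ` C) k M"
  have tN: "topspace N = h ` C"
    using CM kh by (auto simp: N_def topspace_pullback_topology)
  have hm: "homeomorphic_maps N (subtopology M C) k h"
    unfolding homeomorphic_maps_def
  proof (intro conjI ballI)
    have "continuous_map N M (id \<circ> k)" unfolding N_def by (intro continuous_map_pullback) auto
    then show "continuous_map N (subtopology M C) k"
      using tN kh by (auto simp: continuous_map_in_subtopology)
    have "continuous_map (subtopology M C) M (k \<circ> h)"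
      by (rule continuous_map_eq[where f = id]) (auto simp: kh)
    then show "continuous_map (subtopology M C) N h"
      unfolding N_def by (rule continuous_map_pullback') (use CM in auto)
  qed (use tN kh in auto)
  have hmh: "homeomorphic_map (subtopology M C) N h"
    using hm homeomorphic_maps_map homeomorphic_maps_sym by blast
  have mN: "metrizable_space N"
    using M hmh homeomorphic_map_imp_homeomorphic_space homeomorphic_metrizable_space
      metrizable_space_subtopology by blast
  have "subproper_map N Z (f \<circ> k)"
    unfolding subproper_map_def
  proof (intro conjI exI[of _ "h ` E"] allI impI)
    have "continuous_map N M k"
      using hm unfolding homeomorphic_maps_def continuous_map_in_subtopology by blast
    then show "continuous_map N Z (f \<circ> k)" using cf continuous_map_compose by blast
    show "h ` E \<subseteq> topspace N" using EC tN by auto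
    show "(f \<circ> k) ` h ` E = topspace Z"
      using EC kh g by (force simp: E_def image_iff subset_iff)
    fix K assume "precompact_in Z K"
    from pc[OF this] have cl: "compactin M (M closure_of (D \<inter> f -` K))"
      by (simp add: precompact_in_def)
    let ?A = "E \<inter> f -` K"
    have A: "?A \<subseteq> C" using EC by auto
    have "M closure_of ?A \<subseteq> M closure_of (D \<inter> f -` K)"
      using ED by (intro closure_of_mono) auto
    then have c1: "compactin M (M closure_of ?A)"
      using cl closed_compactin closedin_closure_of by blast
    have "M closure_of ?A \<subseteq> C" using A C by (simp add: closure_of_minimal)
    then have "(subtopology M C) closure_of ?A = M closure_of ?A"
      using A by (simp add: closure_of_subtopology_subset closure_of_subtopology Int_absorb1)
    with c1 \<open>M closure_of ?A \<subseteq> C\<close> have c2: "compactin (subtopology M C) ((subtopology M C) closure_of ?A)"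
      by (simp add: compactin_subtopology)
    have hA: "h ` E \<inter> (f \<circ> k) -` K = h ` ?A"
      using EC kh by (auto simp: subset_iff)
    have At: "?A \<subseteq> topspace (subtopology M C)" using A CM by auto
    have "N closure_of (h ` ?A) = h ` ((subtopology M C) closure_of ?A)"
      using homeomorphic_map_closure_of[OF hmh At] .
    then have "compactin N (N closure_of (h ` ?A))"
      using c2 homeomorphic_map_compactness_eq[OF hmh] by (metis compactin_subset_topspace)
    then show "precompact_in N (h ` E \<inter> (f \<circ> k) -` K)"
      unfolding precompact_in_def hA using A tN by auto
  qed
  with Z mN show ?thesis unfolding k_star_metrizable_def by blast
qed

definition sequentially_continuous_map :: "'a topology \<Rightarrow> 'b topology \<Rightarrow> ('a \<Rightarrow> 'b) \<Rightarrow> bool" where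
  "sequentially_continuous_map X Y f \<longleftrightarrow>
     f \<in> topspace X \<rightarrow> topspace Y \<and>
     (\<forall>\<sigma>. range \<sigma> \<subseteq> topspace X \<and> (\<exists>l. limitin X \<sigma> l sequentially) \<longrightarrow>
        (\<exists>l. limitin Y (f \<circ> \<sigma>) l sequentially))"

class topological_real_vector = real_vector + topological_ab_group_add +
  assumes tendsto_scaleR_Pair:
    "((\<lambda>x. fst x *\<^sub>R snd x) \<longlongrightarrow> a *\<^sub>R b) (nhds (a::real) \<times>\<^sub>F nhds b)"

definition continuous_linear_operators ::
    "('a::topological_real_vector \<Rightarrow> 'b::topological_real_vector) set" where
  "continuous_linear_operators = {T. linear T \<and> continuous_on UNIV T}"

definition S_base ::
    "'a set set \<Rightarrow> ('a::topological_real_vector \<Rightarrow> 'b::topological_real_vector) set set" where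
  "S_base \<S> =
     {{T \<in> continuous_linear_operators. T ` \<Union>\<F> \<subseteq> U} |\<F> U.
        finite \<F> \<and> \<F> \<subseteq> \<S> \<and> open U \<and> 0 \<in> U}"

text \<open>A linear topology is translation invariant, so it is determined by its base at the origin:
  a set is open iff with every point \<open>T\<close> it contains a translate \<open>T + B\<close> of a base set \<open>B\<close>.
  The base sets are themselves open when \<open>\<S>\<close> consists of compact sets (\<open>openin_S_base\<close>).\<close>

definition S_topology ::
    "'a set set \<Rightarrow> ('a::topological_real_vector \<Rightarrow> 'b::topological_real_vector) topology" where
  "S_topology \<S> = topology (\<lambda>W. W \<subseteq> continuous_linear_operators \<and>
     (\<forall>T\<in>W. \<exists>B\<in>S_base \<S>. (\<lambda>A x. T x + A x) ` B \<subseteq> W))"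

lemma openin_S_topology:
  fixes W :: "('a::topological_real_vector \<Rightarrow> 'b::topological_real_vector) set"
  shows "openin (S_topology \<S>) W \<longleftrightarrow> W \<subseteq> continuous_linear_operators \<and>
     (\<forall>T\<in>W. \<exists>B\<in>S_base \<S>. (\<lambda>A x. T x + A x) ` B \<subseteq> W)"
proof -
  have *: "\<exists>B\<in>S_base \<S>. B \<subseteq> B1 \<inter> B2" if "B1 \<in> S_base \<S>" "B2 \<in> S_base \<S>"
    for B1 B2 :: "('a \<Rightarrow> 'b) set"
  proof -
    obtain F1 U1 where
      1: "B1 = {T \<in> continuous_linear_operators. T ` \<Union>F1 \<subseteq> U1}"
        "finite F1" "F1 \<subseteq> \<S>" "open U1" "0 \<in> U1"
      using \<open>B1 \<in> S_base \<S>\<close> unfolding S_base_def by blast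
    obtain F2 U2 where
      2: "B2 = {T \<in> continuous_linear_operators. T ` \<Union>F2 \<subseteq> U2}"
        "finite F2" "F2 \<subseteq> \<S>" "open U2" "0 \<in> U2"
      using \<open>B2 \<in> S_base \<S>\<close> unfolding S_base_def by blast
    let ?B = "{T \<in> continuous_linear_operators. T ` \<Union>(F1 \<union> F2) \<subseteq> U1 \<inter> U2} :: ('a \<Rightarrow> 'b) set"
    have "finite (F1 \<union> F2)" "F1 \<union> F2 \<subseteq> \<S>" "open (U1 \<inter> U2)" "0 \<in> U1 \<inter> U2"
      using 1 2 by auto
    then have "?B \<in> S_base \<S>" unfolding S_base_def by blast
    moreover have "?B \<subseteq> B1 \<inter> B2"
    proof
      fix T assume "T \<in> ?B"
      moreover from this have "T ` \<Union>F1 \<subseteq> U1" "T ` \<Union>F2 \<subseteq> U2"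
        by (simp_all add: image_Un)
      ultimately show "T \<in> B1 \<inter> B2" by (simp add: 1(1) 2(1))
    qed
    ultimately show ?thesis by blast
  qed
  have "istopology (\<lambda>W :: ('a \<Rightarrow> 'b) set. W \<subseteq> continuous_linear_operators \<and>
     (\<forall>T\<in>W. \<exists>B\<in>S_base \<S>. (\<lambda>A x. T x + A x) ` B \<subseteq> W))" (is "istopology ?P")
    unfolding istopology_def
  proof (intro conjI allI impI)
    fix V W assume V: "?P V" and W: "?P W"
    then show "V \<inter> W \<subseteq> continuous_linear_operators" by blast
    show "\<forall>T\<in>V \<inter> W. \<exists>B\<in>S_base \<S>. (\<lambda>A x. T x + A x) ` B \<subseteq> V \<inter> W"
    proof
      fix T assume "T \<in> V \<inter> W"
      then have "T \<in> V" "T \<in> W" by auto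
      obtain B1 where 1: "B1 \<in> S_base \<S>" "(\<lambda>A x. T x + A x) ` B1 \<subseteq> V"
        using bspec[OF conjunct2[OF V] \<open>T \<in> V\<close>] by (elim bexE)
      obtain B2 where 2: "B2 \<in> S_base \<S>" "(\<lambda>A x. T x + A x) ` B2 \<subseteq> W"
        using bspec[OF conjunct2[OF W] \<open>T \<in> W\<close>] by (elim bexE)
      obtain B where "B \<in> S_base \<S>" "B \<subseteq> B1 \<inter> B2" using *[OF 1(1) 2(1)] by (elim bexE)
      moreover from this have "(\<lambda>A x. T x + A x) ` B \<subseteq> V \<inter> W"
        by (intro Int_greatest subset_trans[OF image_mono 1(2)] subset_trans[OF image_mono 2(2)]) auto
      ultimately show "\<exists>B\<in>S_base \<S>. (\<lambda>A x. T x + A x) ` B \<subseteq> V \<inter> W" by blast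
    qed
  next
    fix \<K> assume P: "\<forall>K\<in>\<K>. ?P K"
    then show "\<Union>\<K> \<subseteq> continuous_linear_operators" by blast
    show "\<forall>T\<in>\<Union>\<K>. \<exists>B\<in>S_base \<S>. (\<lambda>A x. T x + A x) ` B \<subseteq> \<Union>\<K>"
    proof
      fix T assume "T \<in> \<Union>\<K>"
      then obtain K where K: "K \<in> \<K>" "T \<in> K" by (rule UnionE)
      obtain B where B: "B \<in> S_base \<S>" "(\<lambda>A x. T x + A x) ` B \<subseteq> K"
        using bspec[OF conjunct2[OF bspec[OF P K(1)]] K(2)] by (elim bexE)
      show "\<exists>B\<in>S_base \<S>. (\<lambda>A x. T x + A x) ` B \<subseteq> \<Union>\<K>"
        by (rule bexI[OF _ B(1)]) (rule subset_trans[OF B(2) Union_upper[OF K(1)]])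
    qed
  qed
  then show ?thesis by (simp add: S_topology_def topology_inverse')
qed

lemma add_continuous_linear_operators:
  assumes "S \<in> continuous_linear_operators" "T \<in> continuous_linear_operators"
  shows "(\<lambda>x. S x + T x) \<in> continuous_linear_operators"
  using assms unfolding continuous_linear_operators_def
  by (auto intro: linear_compose_add continuous_on_add)

lemma topspace_S_topology [simp]: "topspace (S_topology \<S>) = continuous_linear_operators"
proof
  show "topspace (S_topology \<S>) \<subseteq> continuous_linear_operators"
    using openin_S_topology openin_topspace by blast
  have "continuous_linear_operators \<in> S_base \<S>"
    unfolding S_base_def mem_Collect_eq
    by (intro exI[of _ "{}"] exI[of _ UNIV]) auto
  then have "openin (S_topology \<S>) continuous_linear_operators"
    unfolding openin_S_topology using add_continuous_linear_operators by blast
  then show "continuous_linear_operators \<subseteq> topspace (S_topology \<S>)" by (rule openin_subset)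
qed

lemma openin_S_base:
  assumes \<S>: "\<And>K. K \<in> \<S> \<Longrightarrow> compact K" and B: "B \<in> S_base \<S>"
  shows "openin (S_topology \<S>) B"
proof -
  obtain F U where BE: "B = {T \<in> continuous_linear_operators. T ` \<Union>F \<subseteq> U}"
    and F: "finite F" "F \<subseteq> \<S>" and U: "open U" "0 \<in> U"
    using B unfolding S_base_def by blast
  show ?thesis unfolding openin_S_topology
  proof (intro conjI ballI)
    show "B \<subseteq> continuous_linear_operators" unfolding BE by auto
    fix T assume T: "T \<in> B"
    have "compact (\<Union>F)" using F \<S> by (auto intro: compact_Union)
    then have K: "compact (T ` \<Union>F)"
      using T unfolding BE continuous_linear_operators_def
      by (auto intro: compact_continuous_image continuous_on_subset)
    have "open ((\<lambda>p. fst p + snd p) -` U)"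
      by (intro open_vimage U continuous_intros)
    moreover have "{0} \<times> T ` \<Union>F \<subseteq> (\<lambda>p. fst p + snd p) -` U"
      using T unfolding BE by (auto simp: image_subset_iff)
    ultimately have "\<exists>V. 0 \<in> V \<and> open V \<and> V \<times> T ` \<Union>F \<subseteq> (\<lambda>p. fst p + snd p) -` U"
      by (intro Elementary_Topology.tube_lemma K)
    then obtain V where V: "0 \<in> V" "open V" "V \<times> T ` \<Union>F \<subseteq> (\<lambda>p. fst p + snd p) -` U"
      by (elim exE conjE) rule
    let ?B = "{A \<in> continuous_linear_operators. A ` \<Union>F \<subseteq> V}"
    have "?B \<in> S_base \<S>" unfolding S_base_def using F V by blast
    moreover have "(\<lambda>A x. T x + A x) ` ?B \<subseteq> B"
    proof clarify
      fix A assume A: "A \<in> continuous_linear_operators" "A ` \<Union>F \<subseteq> V"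
      have "T x + A x \<in> U" if "x \<in> \<Union>F" for x
      proof -
        have "A x \<in> V" "T x \<in> T ` \<Union>F" using A(2) that by (simp_all only: image_subset_iff imageI)
        then have "(A x, T x) \<in> (\<lambda>p. fst p + snd p) -` U" by (intro subsetD[OF V(3)] SigmaI)
        then have "A x + T x \<in> U" by simp
        then show ?thesis by (simp only: add.commute[of "T x" "A x"])
      qed
      moreover have "(\<lambda>x. T x + A x) \<in> continuous_linear_operators"
        using A T by (intro add_continuous_linear_operators) (auto simp: BE)
      ultimately show "(\<lambda>x. T x + A x) \<in> B"
        unfolding BE mem_Collect_eq image_subset_iff by (intro conjI ballI)
    qed
    ultimately show "\<exists>B'\<in>S_base \<S>. (\<lambda>A x. T x + A x) ` B' \<subseteq> B" by blast
  qed
qed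

end

theory Submission
  imports Defs "HOL-Library.Diagonal_Subsequence"
begin

text \<open>The proof follows sequences only. It encodes an operator \<open>g\<close> by a sequence of discrete labels
  \<open>\<phi>\<^sub>0 g, \<phi>\<^sub>1 g, \<dots>\<close>; the metrizable space is a subspace of the product of the discrete label
  spaces. A labelling gives a subproper map as soon as every label takes finitely many values on each
  compact set and a sequence that eventually shares each label with a convergent sequence
  converges to the same limit (\<open>k_star_metrizable_by_labels\<close>). This also uses that the
  target is regular and that its compact sets are sequentially compact; for the operator
  space the former is inherited from \<open>Y\<close>, and the latter holds since countably many
  evaluations, at points dense in \<open>\<Union>\<S>\<close>, separate operators and a compact subset of \<open>Y\<close> meets
  countably many members of the network of \<open>Y\<close>.

  The labels come from a countable network \<open>\<P>\<close> of \<open>X\<close>, closed under finite intersections and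
  adapted to convergent sequences, and an increasing sequence \<open>\<Q>\<^sub>0 \<subseteq> \<Q>\<^sub>1 \<subseteq> \<dots>\<close> of locally finite
  families of closed sets that together form a \<open>k\<close>-network of \<open>Y\<close>. The natural label of \<open>g\<close> at
  \<open>P \<in> \<P>\<close> is the collection of finite \<open>\<F> \<subseteq> \<Q>\<^sub>n\<close> with \<open>g(P) \<subseteq> \<Union>\<F>\<close>. If \<open>g\<^sub>m \<rightarrow> g\<close> and \<open>g(x) \<in> U\<close>, then
  some \<open>P\<close> around \<open>x\<close> is mapped by almost all \<open>g\<^sub>m\<close> into the union of those members of some \<open>\<Q>\<^sub>n\<close>
  that contain \<open>g(x)\<close> and lie in \<open>U\<close> (\<open>convergent_functions_trapped\<close>), so such labels do control limits
  (\<open>equal_labels_imp_same_limit\<close>). They need not take finitely many values on a compact set of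
  operators, however, because \<open>P\<close> is not compact and \<open>g(P)\<close> may meet infinitely many members of
  \<open>\<Q>\<^sub>n\<close>. The remedy is to admit only members of \<open>\<Q>\<^sub>n\<close> linked to the value of \<open>g\<close> at one
  chosen point \<open>p\<close> of \<open>P\<close> by a set \<open>R \<in> \<Q>\<^sub>k\<close> that contains \<open>g(p)\<close> and meets finitely many members of
  \<open>\<Q>\<^sub>n\<close>. On a compact set of operators the values at \<open>p\<close> meet finitely many such \<open>R\<close>, which
  leaves finitely many labels; and trapping \<open>g\<^sub>m(P)\<close> a second time, inside a neighbourhood of \<open>g(x)\<close>
  that meets finitely many members of \<open>\<Q>\<^sub>n\<close>, shows that the admitted members still suffice.

  Sequential continuity of evaluation enters through the rule \<open>T\<^sub>m(x\<^sub>m) \<rightarrow> T(x)\<close>; since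
  the elements of \<open>\<S>\<close> are sequentially compact, pointwise information along convergent
  sequences in \<open>X\<close> yields uniform convergence on them.\<close>

section \<open>Convergent sequences\<close>

lemma compactin_imp_cluster_point:
  fixes s :: "nat \<Rightarrow> 'a"
  assumes K: "compactin X K" and s: "range s \<subseteq> K"
  shows "\<exists>l\<in>K. \<forall>U. openin X U \<and> l \<in> U \<longrightarrow> (\<exists>\<^sub>F i in sequentially. s i \<in> U)"
proof (rule ccontr)
  assume "\<not> ?thesis"
  then have "\<forall>l\<in>K. \<exists>U. openin X U \<and> l \<in> U \<and> (\<forall>\<^sub>F i in sequentially. s i \<notin> U)"
    by (auto simp: frequently_def)
  then obtain U where U: "\<And>l. l \<in> K \<Longrightarrow> openin X (U l) \<and> l \<in> U l \<and> (\<forall>\<^sub>F i in sequentially. s i \<notin> U l)"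
    by metis
  then have "\<exists>\<F>. finite \<F> \<and> \<F> \<subseteq> U ` K \<and> K \<subseteq> \<Union>\<F>"
    by (intro compactinD[OF K]) auto
  then obtain L where L: "finite L" "L \<subseteq> K" "K \<subseteq> \<Union>(U ` L)"
    by (metis finite_subset_image)
  have "\<forall>\<^sub>F i in sequentially. \<forall>l\<in>L. s i \<notin> U l"
    using L(1) by (rule eventually_ball_finite) (use L(2) U in blast)
  then have "\<forall>\<^sub>F i in sequentially. s i \<notin> K"
    by (rule eventually_mono) (use L in auto)
  then show False
    using s by (auto simp: eventually_sequentially)
qed

text \<open>A diagonal subsequence decides membership in every member of the countable family: it is
  eventually inside or eventually outside. Two distinct cluster points would be separated by finitely
  many members, one of which then contains the subsequence from some point on while missing a
  neighbourhood of the second point. Hence there is one cluster point, and it is the limit.\<close>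

lemma compactin_imp_convergent_subsequence:
  fixes s :: "nat \<Rightarrow> 'a"
  assumes K: "compactin X K" and \<A>: "countable \<A>"
    and sep: "\<And>a b. a \<in> K \<Longrightarrow> b \<in> K \<Longrightarrow> a \<noteq> b \<Longrightarrow>
      \<exists>U V \<F>. openin X U \<and> openin X V \<and> a \<in> U \<and> b \<in> V \<and> finite \<F> \<and> \<F> \<subseteq> \<A> \<and>
        U \<inter> K \<subseteq> \<Union>\<F> \<and> V \<inter> K \<inter> \<Union>\<F> = {}"
    and s: "range s \<subseteq> K"
  shows "\<exists>r l. strict_mono r \<and> limitin X (s \<circ> r) l sequentially"
proof -
  \<comment> \<open>The empty set is added so that an enumeration exists even for an empty family.\<close>
  let ?A = "from_nat_into (insert {} \<A>)"
  have A: "range ?A = insert {} \<A>" using \<A> by simp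
  let ?P = "\<lambda>n (r :: nat \<Rightarrow> nat). (\<forall>i. s (r i) \<in> ?A n) \<or> (\<forall>i. s (r i) \<notin> ?A n)"
  interpret subseqs ?P
  proof
    fix n and q :: "nat \<Rightarrow> nat"
    assume "strict_mono q"
    show "\<exists>r. strict_mono r \<and> ?P n (q \<circ> r)"
    proof (cases "infinite {i. s (q i) \<in> ?A n}")
      case True
      then obtain r :: "nat \<Rightarrow> nat" where "strict_mono r" "\<forall>i. r i \<in> {i. s (q i) \<in> ?A n}"
        using infinite_enumerate by blast
      then show ?thesis by auto
    next
      case False
      then have "infinite (- {i. s (q i) \<in> ?A n})"
        by (simp add: Compl_eq_Diff_UNIV Diff_infinite_finite)
      then obtain r :: "nat \<Rightarrow> nat" where "strict_mono r" "\<forall>i. r i \<in> - {i. s (q i) \<in> ?A n}"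
        using infinite_enumerate by blast
      then show ?thesis by auto
    qed
  qed
  define r where "r = diagseq"
  have r: "strict_mono r" unfolding r_def by (rule subseq_diagseq)
  have const: "\<forall>\<^sub>F i in sequentially. s (r i) \<in> B"
    if B: "B \<in> \<A>" "\<exists>\<^sub>F i in sequentially. s (r i) \<in> B" for B
  proof -
    have "B \<in> range ?A" using A B(1) by simp
    then obtain n where n: "B = ?A n" by (rule imageE)
    have "?P n (r \<circ> (+) (Suc n))"
      unfolding r_def by (rule diagseq_holds) auto
    moreover obtain j where "s (r (Suc n + j)) \<in> B"
    proof -
      obtain k where "k \<ge> Suc n" "s (r k) \<in> B"
        using B(2) unfolding frequently_sequentially by blast
      then show ?thesis using that[of "k - Suc n"] by simp
    qed
    ultimately have "\<forall>i. s (r (Suc n + i)) \<in> B"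
      using n by auto
    then show ?thesis
      unfolding eventually_sequentially by (metis le_Suc_ex)
  qed
  have sK: "s i \<in> K" for i using s by auto
  have rs: "range (s \<circ> r) \<subseteq> K" using s by auto
  obtain l where l: "l \<in> K" and cl: "\<And>U. openin X U \<Longrightarrow> l \<in> U \<Longrightarrow> \<exists>\<^sub>F i in sequentially. (s \<circ> r) i \<in> U"
    using compactin_imp_cluster_point[OF K rs] by blast
  have "limitin X (s \<circ> r) l sequentially"
    unfolding limitin_def
  proof (intro conjI allI impI)
    show "l \<in> topspace X" using K l compactin_subset_topspace by blast
    fix W assume W: "openin X W \<and> l \<in> W"
    show "\<forall>\<^sub>F i in sequentially. (s \<circ> r) i \<in> W"
    proof (rule ccontr)
      assume "\<not> ?thesis"
      then have "infinite {i. s (r i) \<notin> W}"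
        by (simp add: eventually_cofinite flip: cofinite_eq_sequentially)
      then obtain q :: "nat \<Rightarrow> nat" where q: "strict_mono q" "\<And>i. s (r (q i)) \<notin> W"
        using infinite_enumerate[of "{i. s (r i) \<notin> W}"] by auto
      have "K - W = K \<inter> (topspace X - W)"
        using compactin_subset_topspace[OF K] by auto
      then have cKW: "compactin X (K - W)"
        using compact_Int_closedin[OF K closedin_diff[OF closedin_topspace conjunct1[OF W]]] by simp
      have "range (s \<circ> r \<circ> q) \<subseteq> K - W" using q s by auto
      from compactin_imp_cluster_point[OF cKW this] obtain b where b: "b \<in> K - W"
        and clb: "\<And>U. openin X U \<Longrightarrow> b \<in> U \<Longrightarrow> \<exists>\<^sub>F i in sequentially. (s \<circ> r \<circ> q) i \<in> U"
        by blast
      obtain U V \<F> where UV: "openin X U" "openin X V" "l \<in> U" "b \<in> V" "finite \<F>" "\<F> \<subseteq> \<A>"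
        "U \<inter> K \<subseteq> \<Union>\<F>" "V \<inter> K \<inter> \<Union>\<F> = {}"
      proof -
        have "b \<in> K" "l \<noteq> b" using b W by auto
        from sep[OF l this] show ?thesis using that by (elim exE conjE)
      qed
      \<comment> \<open>A member visited infinitely often near \<open>l\<close> is never left again, so \<open>b\<close> cannot be approached.\<close>
      have "\<exists>\<^sub>F i in sequentially. \<exists>B\<in>\<F>. s (r i) \<in> B"
        using cl[OF UV(1,3)]
      proof (rule frequently_elim1)
        fix i assume "(s \<circ> r) i \<in> U"
        then have "s (r i) \<in> U \<inter> K" using sK by simp
        then show "\<exists>B\<in>\<F>. s (r i) \<in> B" using UV(7) by blast
      qed
      from frequently_bex_finite[OF UV(5) this]
      obtain B where B: "B \<in> \<F>" "\<exists>\<^sub>F i in sequentially. s (r i) \<in> B"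
        by blast
      have "\<forall>\<^sub>F i in sequentially. s (r (q i)) \<in> B"
        using eventually_subseq[OF q(1) const[OF subsetD[OF UV(6) B(1)] B(2)]] .
      then have "\<forall>\<^sub>F i in sequentially. (s \<circ> r \<circ> q) i \<in> V \<longrightarrow> s (r (q i)) \<in> V \<inter> B"
        by eventually_elim simp
      with clb[OF UV(2,4)] have "\<exists>\<^sub>F i in sequentially. s (r (q i)) \<in> V \<inter> B"
        by (rule frequently_rev_mp)
      moreover have "s (r (q i)) \<notin> V \<inter> B" for i
        using UV(8) B(1) sK by blast
      ultimately show False
        by (simp add: frequently_def)
    qed
  qed
  with r show ?thesis by blast
qed

text \<open>Sequential continuity promises only that images converge somewhere. Interleaving the sequence with
  its limit forces the image limit to be the image of the limit.\<close>

lemma sequentially_continuous_map_limit: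
  assumes f: "sequentially_continuous_map X Y f" and Y: "Hausdorff_space Y"
    and s: "range s \<subseteq> topspace X" and lim: "limitin X s l sequentially"
  shows "limitin Y (f \<circ> s) (f l) sequentially"
proof -
  have l: "l \<in> topspace X" using lim by (rule limitin_topspace)
  define t where "t n = (if even n then s (n div 2) else l)" for n
  have "limitin X t l sequentially"
    unfolding limitin_def
  proof (intro conjI allI impI l)
    fix U assume U: "openin X U \<and> l \<in> U"
    then obtain N where N: "\<And>m. m \<ge> N \<Longrightarrow> s m \<in> U"
      using lim unfolding limitin_sequentially by blast
    have "t m \<in> U" if "m \<ge> 2 * N" for m
      using N[of "m div 2"] U that by (auto simp: t_def)
    then show "\<forall>\<^sub>F m in sequentially. t m \<in> U"
      unfolding eventually_sequentially by blast
  qed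
  moreover have "range t \<subseteq> topspace X" using s l by (auto simp: t_def)
  ultimately obtain y where y: "limitin Y (f \<circ> t) y sequentially"
    using f unfolding sequentially_continuous_map_def by blast
  have odd: "limitin Y (f \<circ> t \<circ> (\<lambda>n. 2 * n + 1)) y sequentially"
    by (rule limitin_subsequence[OF _ y]) (simp add: strict_mono_def)
  have even: "limitin Y (f \<circ> t \<circ> (\<lambda>n. 2 * n)) y sequentially"
    by (rule limitin_subsequence[OF _ y]) (simp add: strict_mono_def)
  have "f \<circ> t \<circ> (\<lambda>n. 2 * n + 1) = (\<lambda>_. f l)" "f \<circ> t \<circ> (\<lambda>n. 2 * n) = f \<circ> s"
    by (auto simp: t_def fun_eq_iff)
  moreover have "limitin Y (\<lambda>_::nat. f l) (f l) sequentially"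
    using f l by (auto simp: sequentially_continuous_map_def)
  ultimately have "y = f l"
    using odd limitin_Hausdorff_unique[OF _ _ trivial_limit_sequentially Y] by metis
  then show ?thesis
    using even \<open>f \<circ> t \<circ> (\<lambda>n. 2 * n) = f \<circ> s\<close> by simp
qed

section \<open>Metrizable spaces of labels\<close>

text \<open>Sending a point to its sequence of labels embeds the set of points into a product of discrete
  spaces. The metrizable space consists of those \<open>p\<close> in the closure of the image for which all
  sequences of points with labels tending to \<open>p\<close> converge to one common point, and the map sends \<open>p\<close> to that point; it is
  continuous by regularity. For compact \<open>K\<close> the labels of points of \<open>K\<close> lie in a product of finite sets,
  which is compact, and every label sequence adherent to them is in the metrizable space because \<open>K\<close> is
  sequentially compact.\<close>

lemma k_star_metrizable_by_labels:
  fixes Z :: "'a topology" and \<phi> :: "nat \<Rightarrow> 'a \<Rightarrow> 'l"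
  assumes haus: "Hausdorff_space Z" and reg: "regular_space Z"
    and subseq: "\<And>K (s :: nat \<Rightarrow> 'a). compactin Z K \<Longrightarrow> range s \<subseteq> K \<Longrightarrow>
      \<exists>(r :: nat \<Rightarrow> nat) l. strict_mono r \<and> limitin Z (s \<circ> r) l sequentially"
    and fin: "\<And>K n. compactin Z K \<Longrightarrow> finite (\<phi> n ` K)"
    and lim: "\<And>z w l. range z \<subseteq> topspace Z \<Longrightarrow> range w \<subseteq> topspace Z \<Longrightarrow>
      limitin Z z l sequentially \<Longrightarrow>
      (\<And>n. \<forall>\<^sub>F m in sequentially. \<phi> n (w m) = \<phi> n (z m)) \<Longrightarrow> limitin Z w l sequentially"
  shows "k_star_metrizable Z"
proof -
  define conv where "conv w p \<longleftrightarrow>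
    range w \<subseteq> topspace Z \<and> (\<forall>n. \<forall>\<^sub>F m in sequentially. \<phi> n (w m) = p n)" for w p
  define G where "G = {p. (\<exists>w. conv w p) \<and> (\<exists>z. \<forall>w. conv w p \<longrightarrow> limitin Z w z sequentially)}"
  define P where "P = product_topology (\<lambda>_::nat. discrete_topology (UNIV::'l set)) UNIV"
  define M where "M = subtopology P G"
  have topP: "topspace P = UNIV" by (simp add: P_def)
  have topM: "topspace M = G" by (simp add: M_def topP)
  have "metrizable_space P"
    unfolding P_def metrizable_space_product_topology by auto
  then have metM: "metrizable_space M"
    by (simp add: M_def metrizable_space_subtopology)
  have cyl: "openin P {q. \<forall>i<n. q i = p i}" for p n
  proof -
    have "openin P (PiE UNIV (\<lambda>i. if i < n then {p i} else UNIV))"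
      unfolding P_def openin_PiE_gen
      by (auto intro: finite_subset[of _ "{..<n}"] split: if_splits)
    also have "PiE UNIV (\<lambda>i. if i < n then {p i} else UNIV) = {q. \<forall>i<n. q i = p i}"
      by (auto simp: PiE_def Pi_def split: if_splits)
    finally show ?thesis .
  qed
  have convI: "conv w p" if "\<And>m. w m \<in> topspace Z" "\<And>m i. i < m \<Longrightarrow> \<phi> i (w m) = p i" for w p
    unfolding conv_def eventually_sequentially
  proof (intro conjI allI)
    show "\<exists>N. \<forall>m\<ge>N. \<phi> i (w m) = p i" for i
      by (rule exI[of _ "Suc i"]) (use that(2) in auto)
  qed (use that(1) in auto)
  obtain f where f: "\<And>p w. p \<in> G \<Longrightarrow> conv w p \<Longrightarrow> limitin Z w (f p) sequentially"
  proof -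
    have "\<forall>p. \<exists>z. p \<in> G \<longrightarrow> (\<forall>w. conv w p \<longrightarrow> limitin Z w z sequentially)"
      by (auto simp: G_def)
    from choice[OF this] show ?thesis using that by blast
  qed
  \<comment> \<open>One convergent sequence with labels tending to \<open>p\<close> forces the same limit on all others.\<close>
  have GI: "p \<in> G" if "conv w p" "limitin Z w z sequentially" for p w z
  proof -
    have "limitin Z w' z sequentially" if w': "conv w' p" for w'
    proof (rule lim[OF _ _ \<open>limitin Z w z sequentially\<close>])
      show "\<forall>\<^sub>F m in sequentially. \<phi> n (w' m) = \<phi> n (w m)" for n
      proof -
        have "\<forall>\<^sub>F m in sequentially. \<phi> n (w' m) = p n" "\<forall>\<^sub>F m in sequentially. \<phi> n (w m) = p n"
          using w' \<open>conv w p\<close> by (auto simp: conv_def)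
        then show ?thesis by eventually_elim simp
      qed
    qed (use w' \<open>conv w p\<close> in \<open>auto simp: conv_def\<close>)
    then show ?thesis using that by (auto simp: G_def)
  qed
  define \<Phi> where "\<Phi> z = (\<lambda>n. \<phi> n z)" for z
  have conv\<Phi>: "conv (\<lambda>_. z) (\<Phi> z)" if "z \<in> topspace Z" for z
    using that by (auto simp: conv_def \<Phi>_def)
  have \<Phi>G: "\<Phi> z \<in> G" if "z \<in> topspace Z" for z
    by (rule GI[OF conv\<Phi>[OF that], where z = z]) (simp add: that)
  have f\<Phi>: "f (\<Phi> z) = z" if "z \<in> topspace Z" for z
  proof -
    have "limitin Z (\<lambda>_. z) (f (\<Phi> z)) sequentially"
      by (rule f[OF \<Phi>G[OF that] conv\<Phi>[OF that]])
    moreover have "limitin Z (\<lambda>_. z) z sequentially" using that by simp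
    ultimately show ?thesis
      using limitin_Hausdorff_unique[OF _ _ _ haus] trivial_limit_sequentially by blast
  qed
  have fG: "f p \<in> topspace Z" if "p \<in> G" for p
  proof -
    obtain w where "conv w p" using \<open>p \<in> G\<close> by (auto simp: G_def)
    from limitin_topspace[OF f[OF that this]] show ?thesis .
  qed
  have contf: "continuous_map M Z f"
    unfolding continuous_map
  proof (intro conjI allI impI)
    show "f ` topspace M \<subseteq> topspace Z" using fG topM by auto
    fix U assume U: "openin Z U"
    have "\<exists>T. openin M T \<and> p \<in> T \<and> T \<subseteq> {x \<in> topspace M. f x \<in> U}" if p: "p \<in> G" "f p \<in> U" for p
    proof -
      obtain V C where V: "openin Z V" "closedin Z C" "f p \<in> V" "V \<subseteq> C" "C \<subseteq> U"
        using reg U p(2) unfolding neighbourhood_base_of_closedin[symmetric] neighbourhood_base_of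
        by metis
      \<comment> \<open>Otherwise points outside \<open>V\<close> with labels tending to \<open>p\<close> would converge to \<open>f p\<close>.\<close>
      have "\<exists>n. \<forall>z\<in>topspace Z. (\<forall>i<n. \<phi> i z = p i) \<longrightarrow> z \<in> V"
      proof (rule ccontr)
        assume "\<not> ?thesis"
        then obtain w where w: "\<And>n. w n \<in> topspace Z" "\<And>n i. i < n \<Longrightarrow> \<phi> i (w n) = p i" "\<And>n. w n \<notin> V"
          by metis
        have "limitin Z w (f p) sequentially"
          by (rule f[OF p(1) convI]) (use w in auto)
        then have "\<forall>\<^sub>F m in sequentially. w m \<in> V" using V limitinD by metis
        then show False using w(3) by (auto simp: eventually_sequentially)
      qed
      then obtain n where n: "\<And>z. z \<in> topspace Z \<Longrightarrow> (\<And>i. i < n \<Longrightarrow> \<phi> i z = p i) \<Longrightarrow> z \<in> V"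
        by metis
      have "f q \<in> U" if q: "q \<in> G" "\<forall>i<n. q i = p i" for q
      proof -
        obtain w where w: "conv w q" using q by (auto simp: G_def)
        have "\<forall>\<^sub>F m in sequentially. \<forall>i\<in>{..<n}. \<phi> i (w m) = q i"
          using w by (intro eventually_ball_finite) (auto simp: conv_def)
        then have "\<forall>\<^sub>F m in sequentially. w m \<in> C"
        proof (rule eventually_mono)
          fix m assume "\<forall>i\<in>{..<n}. \<phi> i (w m) = q i"
          then have "w m \<in> V" using q(2) w by (intro n) (auto simp: conv_def)
          then show "w m \<in> C" using V(4) by blast
        qed
        then have "f q \<in> C"
          using limitin_closedin[OF f[OF q(1) w] V(2)] trivial_limit_sequentially by blast
        then show ?thesis using V by auto
      qed
      then show ?thesis
        by (intro exI[of _ "{q. \<forall>i<n. q i = p i} \<inter> G"])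
           (use p cyl in \<open>auto simp: M_def topP openin_subtopology_Int\<close>)
    qed
    then show "openin M {x \<in> topspace M. f x \<in> U}"
      by (subst openin_subopen) (auto simp: topM)
  qed
  have "subproper_map M Z f"
    unfolding subproper_map_def
  proof (intro conjI exI[of _ "\<Phi> ` topspace Z"] allI impI contf)
    show "\<Phi> ` topspace Z \<subseteq> topspace M" using \<Phi>G topM by auto
    show "f ` \<Phi> ` topspace Z = topspace Z" using f\<Phi> by force
    fix K assume "precompact_in Z K"
    then have KZ: "K \<subseteq> topspace Z" and cK: "compactin Z (Z closure_of K)"
      by (auto simp: precompact_in_def)
    have KcK: "K \<subseteq> Z closure_of K" using KZ by (rule closure_of_subset)
    have DK: "\<Phi> ` topspace Z \<inter> f -` K = \<Phi> ` K"
      using f\<Phi> KZ by force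
    let ?H = "P closure_of (\<Phi> ` K)" and ?B = "PiE UNIV (\<lambda>n. \<phi> n ` K)"
    have "finite (\<phi> n ` K)" for n
      using fin[OF cK] KcK by (meson finite_subset image_mono)
    then have cB: "compactin P ?B"
      unfolding P_def compactin_PiE by (auto intro: finite_imp_compactin)
    have clB: "closedin P ?B"
      unfolding P_def closedin_product_topology by auto
    have "?H \<subseteq> ?B"
      by (rule closure_of_minimal[OF _ clB]) (auto simp: \<Phi>_def)
    then have cH: "compactin P ?H"
      using cB closed_compactin closedin_closure_of by blast
    have HG: "?H \<subseteq> G"
    proof
      fix p assume p: "p \<in> ?H"
      have "\<exists>z\<in>K. \<forall>i<n. \<phi> i z = p i" for n
      proof -
        have "\<forall>T. p \<in> T \<and> openin P T \<longrightarrow> (\<exists>y. y \<in> \<Phi> ` K \<and> y \<in> T)"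
          using p unfolding in_closure_of by (rule conjunct2)
        then have "\<exists>y. y \<in> \<Phi> ` K \<and> y \<in> {q. \<forall>i<n. q i = p i}"
          by (rule allE[of _ "{q. \<forall>i<n. q i = p i}"]) (simp add: cyl)
        then show ?thesis by (auto simp: \<Phi>_def)
      qed
      then obtain w where w: "\<And>n. w n \<in> K" "\<And>n i. i < n \<Longrightarrow> \<phi> i (w n) = p i" by metis
      then obtain r :: "nat \<Rightarrow> nat" and l where r: "strict_mono r" "limitin Z (w \<circ> r) l sequentially"
        using subseq[OF cK, of w] KcK by (meson image_subsetI subsetD)
      have "conv (w \<circ> r) p"
      proof (rule convI)
        show "\<phi> i ((w \<circ> r) m) = p i" if "i < m" for m i
          using w(2)[of i "r m"] seq_suble[OF r(1), of m] that by simp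
      qed (use w KZ in auto)
      then show "p \<in> G" using GI r by blast
    qed
    have sub: "\<Phi> ` K \<subseteq> G" using \<Phi>G KZ by auto
    have "M closure_of (\<Phi> ` K) = ?H"
      unfolding M_def using HG sub by (simp add: closure_of_subtopology Int_absorb1)
    then have "compactin M (M closure_of (\<Phi> ` K))"
      using cH HG by (simp add: M_def compactin_subtopology)
    then show "precompact_in M (\<Phi> ` topspace Z \<inter> f -` K)"
      unfolding precompact_in_def DK using sub topM by auto
  qed
  then show ?thesis using k_star_metrizableI haus metM by blast
qed

section \<open>Networks and sequences\<close>

lemma compact_insert_limit_range:
  fixes s :: "nat \<Rightarrow> 'a::topological_space"
  assumes s: "s \<longlonglongrightarrow> l"
  shows "compact (insert l (range s))"
proof (rule compactI)
  fix \<C> assume \<C>: "\<forall>U\<in>\<C>. open U" "insert l (range s) \<subseteq> \<Union>\<C>"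
  show "\<exists>\<F>. \<F> \<subseteq> \<C> \<and> finite \<F> \<and> insert l (range s) \<subseteq> \<Union>\<F>"
  proof -
    obtain U where U: "U \<in> \<C>" "l \<in> U" using \<C>(2) by auto
    then obtain N where N: "\<And>m. m \<ge> N \<Longrightarrow> s m \<in> U"
      using topological_tendstoD[OF s, of U] \<C>(1) by (auto simp: eventually_sequentially)
    have "\<forall>m. \<exists>V. V \<in> \<C> \<and> s m \<in> V" using \<C>(2) by auto
    then obtain V where V: "\<And>m. V m \<in> \<C> \<and> s m \<in> V m" by metis
    have "s m \<in> \<Union>(insert U (V ` {..<N}))" for m
      using N V by (cases "m < N") auto
    then have "insert l (range s) \<subseteq> \<Union>(insert U (V ` {..<N}))"
      using U by auto
    then show ?thesis
      using U(1) V by (intro exI[of _ "insert U (V ` {..<N})"]) blast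
  qed
qed

text \<open>What is used of an \<open>\<aleph>\<^sub>0\<close>-space: finite intersections turn the members that contain a limit and
  almost all terms of a sequence into a decreasing sequence shrinking to the limit.\<close>

locale countable_cs_network =
  fixes \<P> :: "'x::topological_space set set"
  assumes countable: "countable \<P>"
    and Int: "\<And>P Q. P \<in> \<P> \<Longrightarrow> Q \<in> \<P> \<Longrightarrow> P \<inter> Q \<in> \<P>"
    and cs: "\<And>(s :: nat \<Rightarrow> 'x) x U. s \<longlonglongrightarrow> x \<Longrightarrow> open U \<Longrightarrow> x \<in> U \<Longrightarrow>
      \<exists>P\<in>\<P>. P \<subseteq> U \<and> x \<in> P \<and> (\<forall>\<^sub>F m in sequentially. s m \<in> P)"

text \<open>What is used of an \<open>\<aleph>\<close>-space: the index \<open>n\<close> is an accumulated one, so that finitely many members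
  of the whole \<open>k\<close>-network always lie in a single family, and closed members contain the limits of
  sequences that visit them infinitely often.\<close>

locale closed_k_network =
  fixes \<Q> :: "nat \<Rightarrow> 'y::topological_space set set"
  assumes mono: "mono \<Q>"
    and closed: "\<And>n Q. Q \<in> \<Q> n \<Longrightarrow> closed Q"
    and locally_finite: "\<And>n y. \<exists>V. open V \<and> y \<in> V \<and> finite {Q \<in> \<Q> n. Q \<inter> V \<noteq> {}}"
    and net: "\<And>K U. compact K \<Longrightarrow> open U \<Longrightarrow> K \<subseteq> U \<Longrightarrow>
      \<exists>n. \<exists>\<F>\<subseteq>\<Q> n. finite \<F> \<and> K \<subseteq> \<Union>\<F> \<and> \<Union>\<F> \<subseteq> U"

text \<open>A sequence with its limit is compact, so one finite union of members of the \<open>k\<close>-network contains a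
  tail together with the limit. Take all finite intersections of finite unions.\<close>

lemma countable_k_network_imp_countable_cs_network:
  fixes \<N> :: "'x::topological_space set set"
  assumes \<N>: "countable \<N>" and net: "k_network euclidean \<N>"
  obtains \<P> :: "'x set set" where "countable_cs_network \<P>"
proof -
  define \<U> where "\<U> = Union ` {\<F>. finite \<F> \<and> \<F> \<subseteq> \<N>}"
  define \<P> where "\<P> = Inter ` {\<F>. finite \<F> \<and> \<F> \<subseteq> \<U>}"
  have cU: "countable \<U>"
    unfolding \<U>_def using countable_Collect_finite_subset[OF \<N>] by (rule countable_image)
  have "countable_cs_network \<P>"
  proof
    show "countable \<P>"
      unfolding \<P>_def using countable_Collect_finite_subset[OF cU] by (rule countable_image)
  next
    fix P Q assume "P \<in> \<P>" "Q \<in> \<P>"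
    then obtain \<F> \<G> where "finite \<F>" "\<F> \<subseteq> \<U>" "finite \<G>" "\<G> \<subseteq> \<U>" "P = \<Inter>\<F>" "Q = \<Inter>\<G>"
      by (auto simp: \<P>_def)
    then have "P \<inter> Q = \<Inter>(\<F> \<union> \<G>)" "finite (\<F> \<union> \<G>)" "\<F> \<union> \<G> \<subseteq> \<U>" by auto
    then show "P \<inter> Q \<in> \<P>" unfolding \<P>_def by blast
  next
    fix s :: "nat \<Rightarrow> 'x" and x U
    assume s: "s \<longlonglongrightarrow> x" and U: "open U" "x \<in> U"
    then obtain N where N: "\<And>m. m \<ge> N \<Longrightarrow> s m \<in> U"
      using topological_tendstoD[OF s, of U] by (auto simp: eventually_sequentially)
    let ?K = "insert x (range (\<lambda>m. s (m + N)))"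
    have "compact ?K"
      by (rule compact_insert_limit_range) (rule LIMSEQ_ignore_initial_segment[OF s])
    moreover have "?K \<subseteq> U" using U N by auto
    ultimately obtain \<F> where \<F>: "finite \<F>" "\<F> \<subseteq> \<N>" "?K \<subseteq> \<Union>\<F>" "\<Union>\<F> \<subseteq> U"
      using net U(1) unfolding k_network_def
      by (metis compactin_euclidean_iff open_openin)
    have "\<Union>\<F> \<in> \<U>" using \<F> by (auto simp: \<U>_def)
    then have "\<Inter>{\<Union>\<F>} \<in> \<P>" unfolding \<P>_def by blast
    moreover have "\<forall>\<^sub>F m in sequentially. s m \<in> \<Union>\<F>"
      unfolding eventually_sequentially
    proof (intro exI allI impI)
      fix m assume "m \<ge> N"
      then have "s m = s (m - N + N)" by simp
      then have "s m \<in> ?K" by blast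
      then show "s m \<in> \<Union>\<F>" using \<F> by blast
    qed
    ultimately show "\<exists>P\<in>\<P>. P \<subseteq> U \<and> x \<in> P \<and> (\<forall>\<^sub>F m in sequentially. s m \<in> P)"
      using \<F> by (intro bexI[of _ "\<Union>\<F>"]) auto
  qed
  then show thesis by (rule that)
qed

text \<open>Closures keep local finiteness, and regularity leaves room for them between a compact set and an
  open set around it.\<close>

lemma sigma_locally_finite_k_network_closed:
  fixes \<N> :: "'y::topological_space set set"
  assumes reg: "regular_space (euclidean :: 'y topology)"
    and slf: "sigma_locally_finite_in euclidean \<N>" and kn: "k_network euclidean \<N>"
  obtains \<Q> :: "nat \<Rightarrow> 'y set set" where "closed_k_network \<Q>"
proof -
  obtain \<A> :: "nat \<Rightarrow> 'y set set" where lf: "\<And>n. locally_finite_in euclidean (\<A> n)"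
    and net: "k_network euclidean (\<Union>n. \<A> n)"
    using slf kn by (auto simp: sigma_locally_finite_in_def)
  define \<Q> where "\<Q> n = (\<Union>i\<le>n. closure ` \<A> i)" for n
  have lfc: "\<exists>V. open V \<and> y \<in> V \<and> finite {Q \<in> closure ` \<A> n. Q \<inter> V \<noteq> {}}" for n y
    using locally_finite_in_closure[OF lf[of n]] by (auto simp: locally_finite_in_def)
  have mono: "mono \<Q>" unfolding \<Q>_def by (intro monoI UN_mono) auto
  have "closed_k_network \<Q>"
  proof
    show "mono \<Q>" by fact
    show "closed Q" if "Q \<in> \<Q> n" for n Q using that by (auto simp: \<Q>_def)
    show "\<exists>V. open V \<and> y \<in> V \<and> finite {Q \<in> \<Q> n. Q \<inter> V \<noteq> {}}" for n y
    proof -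
      from choice[OF allI[OF lfc[where y = y]]] obtain V where
        V: "\<forall>i. open (V i) \<and> y \<in> V i \<and> finite {Q \<in> closure ` \<A> i. Q \<inter> V i \<noteq> {}}" ..
      have "{Q \<in> \<Q> n. Q \<inter> (\<Inter>i\<le>n. V i) \<noteq> {}} \<subseteq> (\<Union>i\<le>n. {Q \<in> closure ` \<A> i. Q \<inter> V i \<noteq> {}})"
        by (force simp: \<Q>_def)
      moreover have "finite (\<Union>i\<le>n. {Q \<in> closure ` \<A> i. Q \<inter> V i \<noteq> {}})"
        using V by (intro finite_UN_I finite_atMost) blast
      ultimately have "finite {Q \<in> \<Q> n. Q \<inter> (\<Inter>i\<le>n. V i) \<noteq> {}}"
        by (rule finite_subset)
      then show ?thesis
        using V by (intro exI[of _ "\<Inter>i\<le>n. V i"] conjI open_INT finite_atMost INT_I ballI) blast+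
    qed
    fix K U :: "'y set" assume K: "compact K" and U: "open U" "K \<subseteq> U"
    obtain V W where VW: "open V" "open W" "K \<subseteq> V" "- U \<subseteq> W" "disjnt V W"
    proof -
      have "compactin euclidean K" "closedin euclidean (- U)" "disjnt K (- U)"
        using K U by (auto simp: disjnt_iff closed_Compl)
      from regular_space_compact_closed_separation[OF reg this] show ?thesis
        using that by auto
    qed
    then obtain \<F> where \<F>: "finite \<F>" "\<F> \<subseteq> (\<Union>n. \<A> n)" "K \<subseteq> \<Union>\<F>" "\<Union>\<F> \<subseteq> V"
      using net K unfolding k_network_def by (metis compactin_euclidean_iff open_openin)
    have clF: "closure F \<subseteq> U" if "F \<in> \<F>" for F
    proof -
      have "F \<subseteq> - W" using \<F>(4) that VW(5) by (auto simp: disjnt_iff)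
      then have "closure F \<subseteq> - W" using VW(2) by (intro closure_minimal) auto
      then show ?thesis using VW(4) by auto
    qed
    have "\<forall>F\<in>\<F>. \<exists>n. F \<in> \<A> n" using \<F>(2) by auto
    then obtain n where n: "\<And>F. F \<in> \<F> \<Longrightarrow> F \<in> \<A> (n F)" by metis
    obtain N where N: "\<And>F. F \<in> \<F> \<Longrightarrow> n F \<le> N"
      using finite_nat_set_iff_bounded_le[of "n ` \<F>"] \<F>(1) by auto
    have "closure ` \<F> \<subseteq> \<Q> N" using n N by (force simp: \<Q>_def)
    moreover have "K \<subseteq> \<Union>(closure ` \<F>)"
    proof
      fix y assume "y \<in> K"
      then obtain F where "F \<in> \<F>" "y \<in> F" using \<F>(3) by auto
      then show "y \<in> \<Union>(closure ` \<F>)" using closure_subset by (intro UN_I) auto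
    qed
    moreover have "\<Union>(closure ` \<F>) \<subseteq> U" using clF by (rule UN_least)
    ultimately show "\<exists>n. \<exists>\<G>\<subseteq>\<Q> n. finite \<G> \<and> K \<subseteq> \<Union>\<G> \<and> \<Union>\<G> \<subseteq> U"
      using finite_imageI[OF \<F>(1)] by (intro exI conjI)
  qed
  then show thesis by (rule that)
qed

lemma countable_network_dense_subset:
  fixes \<N> :: "'a::topological_space set set" and A :: "'a set"
  assumes \<N>: "countable \<N>"
    and net: "\<And>x U. open U \<Longrightarrow> x \<in> U \<Longrightarrow> \<exists>N\<in>\<N>. x \<in> N \<and> N \<subseteq> U"
  obtains E where "countable E" "E \<subseteq> A" "closure E = closure A"
proof
  define c where "c N = (SOME x. x \<in> N \<inter> A)" for N
  have c: "c N \<in> N \<inter> A" if "N \<inter> A \<noteq> {}" for N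
    unfolding c_def using that by (metis equals0I someI)
  let ?E = "c ` {N \<in> \<N>. N \<inter> A \<noteq> {}}"
  show "countable ?E" using \<N> by auto
  show "?E \<subseteq> A" using c by auto
  then have "closure ?E \<subseteq> closure A" by (rule closure_mono)
  moreover have "closure A \<subseteq> closure ?E"
  proof (intro closure_minimal closed_closure subsetI)
    fix x assume x: "x \<in> A"
    have "?E \<inter> U \<noteq> {}" if U: "open U" "x \<in> U" for U
    proof -
      obtain N where N: "N \<in> \<N>" "x \<in> N" "N \<subseteq> U" using net[OF U] by blast
      then have "N \<inter> A \<noteq> {}" using x by blast
      then show ?thesis using c[of N] N by blast
    qed
    from this[of "- closure ?E"] show "x \<in> closure ?E"
      using closure_subset[of ?E] by auto
  qed
  ultimately show "closure ?E = closure A" by blast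
qed

text \<open>Points of \<open>C\<close> chosen from infinitely many members would cluster at a point near which only finitely
  many members pass. Cluster points are assumed instead of compactness because evaluation need not be
  continuous at every point, so the values of a compact set of operators at a point need not form a
  compact set.\<close>

lemma locally_finite_meets_finitely_many:
  fixes \<Q> :: "'a::topological_space set set"
  assumes lf: "\<And>y. \<exists>V. open V \<and> y \<in> V \<and> finite {Q \<in> \<Q>. Q \<inter> V \<noteq> {}}"
    and cl: "\<And>s :: nat \<Rightarrow> 'a. range s \<subseteq> C \<Longrightarrow>
      \<exists>l. \<forall>U. open U \<and> l \<in> U \<longrightarrow> (\<exists>\<^sub>F i in sequentially. s i \<in> U)"
  shows "finite {Q \<in> \<Q>. Q \<inter> C \<noteq> {}}"
proof (rule ccontr)
  assume "\<not> ?thesis"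
  then obtain R :: "nat \<Rightarrow> 'a set" where R: "inj R" "range R \<subseteq> {Q \<in> \<Q>. Q \<inter> C \<noteq> {}}"
    using infinite_countable_subset by blast
  then have "\<forall>i. \<exists>y. y \<in> R i \<inter> C" by blast
  then obtain s where s: "\<And>i. s i \<in> R i \<inter> C" by metis
  then have "range s \<subseteq> C" by blast
  then obtain l where l: "\<And>U. open U \<Longrightarrow> l \<in> U \<Longrightarrow> \<exists>\<^sub>F i in sequentially. s i \<in> U"
    using cl by blast
  obtain V where V: "open V" "l \<in> V" "finite {Q \<in> \<Q>. Q \<inter> V \<noteq> {}}" using lf by blast
  have "R ` {i. s i \<in> V} \<subseteq> {Q \<in> \<Q>. Q \<inter> V \<noteq> {}}"
    using R(2) s by blast
  then have "finite (R ` {i. s i \<in> V})" using V(3) finite_subset by blast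
  then have "finite {i. s i \<in> V}" using R(1) by (metis finite_imageD inj_on_subset subset_UNIV)
  then show False
    using l[OF V(1,2)] by (simp add: frequently_cofinite flip: cofinite_eq_sequentially)
qed

lemma regular_closed_neighbourhood:
  fixes W :: "'a::topological_space set"
  assumes reg: "regular_space (euclidean :: 'a topology)" and "open W" "x \<in> W"
  obtains U C where "open U" "closed C" "x \<in> U" "U \<subseteq> C" "C \<subseteq> W"
proof -
  have "\<exists>U C. openin euclidean U \<and> closedin euclidean C \<and> x \<in> U \<and> U \<subseteq> C \<and> C \<subseteq> W"
    using reg assms(2,3) unfolding neighbourhood_base_of_closedin[symmetric] neighbourhood_base_of
    by simp
  then show thesis using that by auto
qed

lemma k_network_separates_points:
  fixes K :: "'a::t2_space set"
  assumes reg: "regular_space (euclidean :: 'a topology)" and K: "compact K"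
    and net: "\<And>C U. compact C \<Longrightarrow> open U \<Longrightarrow> C \<subseteq> U \<Longrightarrow>
      \<exists>\<F>\<subseteq>\<N>. finite \<F> \<and> C \<subseteq> \<Union>\<F> \<and> \<Union>\<F> \<subseteq> U"
    and "a \<noteq> b"
  obtains U V \<F> where "open U" "open V" "a \<in> U" "b \<in> V" "finite \<F>"
    "\<F> \<subseteq> {N \<in> \<N>. N \<inter> K \<noteq> {}}" "U \<inter> K \<subseteq> \<Union>\<F>" "V \<inter> \<Union>\<F> = {}"
proof -
  obtain U0 V where UV: "open U0" "open V" "a \<in> U0" "b \<in> V" "U0 \<inter> V = {}"
    using hausdorff[OF \<open>a \<noteq> b\<close>] by blast
  obtain U C where U: "open U" "closed C" "a \<in> U" "U \<subseteq> C" "C \<subseteq> U0"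
    using regular_closed_neighbourhood[OF reg UV(1,3)] .
  have "compact (K \<inter> C)" "K \<inter> C \<subseteq> U0" using K U(2,5) by auto
  from net[OF this(1) UV(1) this(2)]
  obtain \<F> where \<F>: "\<F> \<subseteq> \<N>" "finite \<F>" "K \<inter> C \<subseteq> \<Union>\<F>" "\<Union>\<F> \<subseteq> U0"
    by (elim exE conjE)
  show thesis
  proof (rule that[OF U(1) UV(2) U(3) UV(4)])
    show "finite {N \<in> \<F>. N \<inter> K \<noteq> {}}" using \<F>(2) by simp
    show "{N \<in> \<F>. N \<inter> K \<noteq> {}} \<subseteq> {N \<in> \<N>. N \<inter> K \<noteq> {}}" using \<F>(1) by blast
    show "U \<inter> K \<subseteq> \<Union>{N \<in> \<F>. N \<inter> K \<noteq> {}}" using \<F>(3) U(4) by blast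
    show "V \<inter> \<Union>{N \<in> \<F>. N \<inter> K \<noteq> {}} = {}" using \<F>(4) UV(5) by blast
  qed
qed

lemma countable_k_network_convergent_subsequence:
  fixes K :: "'a::t2_space set" and \<N> :: "'a set set" and s :: "nat \<Rightarrow> 'a"
  assumes reg: "regular_space (euclidean :: 'a topology)" and K: "compact K"
    and \<N>: "countable \<N>" and net: "k_network euclidean \<N>" and s: "range s \<subseteq> K"
  obtains r :: "nat \<Rightarrow> nat" and l where "strict_mono r" "(s \<circ> r) \<longlonglongrightarrow> l"
proof -
  have "\<exists>(r :: nat \<Rightarrow> nat) l. strict_mono r \<and> limitin euclidean (s \<circ> r) l sequentially"
  proof (rule compactin_imp_convergent_subsequence[where K = K and \<A> = \<N>])
    show "countable \<N>" "range s \<subseteq> K" by fact+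
    show "compactin euclidean K" using K by simp
    fix a b :: 'a assume "a \<noteq> b"
    have "\<exists>\<F>\<subseteq>\<N>. finite \<F> \<and> C \<subseteq> \<Union>\<F> \<and> \<Union>\<F> \<subseteq> U" if "compact C" "open U" "C \<subseteq> U" for C U
      using net that unfolding k_network_def by (metis compactin_euclidean_iff open_openin)
    from k_network_separates_points[OF reg K this \<open>a \<noteq> b\<close>]
    obtain U V \<F> where "open U" "open V" "a \<in> U" "b \<in> V" "finite \<F>"
      "\<F> \<subseteq> {N \<in> \<N>. N \<inter> K \<noteq> {}}" "U \<inter> K \<subseteq> \<Union>\<F>" "V \<inter> \<Union>\<F> = {}" .
    then show "\<exists>U V \<F>. openin euclidean U \<and> openin euclidean V \<and> a \<in> U \<and> b \<in> V \<and> finite \<F> \<and>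
        \<F> \<subseteq> \<N> \<and> U \<inter> K \<subseteq> \<Union>\<F> \<and> V \<inter> K \<inter> \<Union>\<F> = {}"
      by (intro exI[of _ U] exI[of _ V] exI[of _ \<F>]) auto
  qed
  then show thesis using that by auto
qed

section \<open>The topology of uniform convergence on a family of compact sets\<close>

lemma diff_continuous_linear_operators:
  assumes "S \<in> continuous_linear_operators" "T \<in> continuous_linear_operators"
  shows "(\<lambda>x. S x - T x) \<in> continuous_linear_operators"
  using assms unfolding continuous_linear_operators_def
  by (auto intro: linear_compose_sub continuous_on_diff)

lemma continuous_linear_operators_eqI:
  fixes S T :: "'x::topological_real_vector \<Rightarrow> 'y::{topological_real_vector, t2_space}"
  assumes S: "S \<in> continuous_linear_operators" and T: "T \<in> continuous_linear_operators"
    and E: "closure E = UNIV" and eq: "\<And>x. x \<in> E \<Longrightarrow> S x = T x"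
  shows "S = T"
proof -
  have "closed {x. S x = T x}"
    using S T by (intro closed_Collect_eq) (auto simp: continuous_linear_operators_def)
  then have "closure E \<subseteq> {x. S x = T x}"
    using eq by (intro closure_minimal) auto
  then show ?thesis using E by (auto simp: fun_eq_iff)
qed

lemma S_baseI:
  assumes "finite \<F>" "\<F> \<subseteq> \<S>" "open U" "0 \<in> U"
  shows "{A \<in> continuous_linear_operators. A ` \<Union>\<F> \<subseteq> U} \<in> S_base \<S>"
  using assms unfolding S_base_def by blast

lemma openin_S_topology_translation:
  assumes W: "openin (S_topology \<S>) W" and T: "T \<in> continuous_linear_operators"
  shows "openin (S_topology \<S>) ((\<lambda>A x. T x + A x) ` W)"
  unfolding openin_S_topology
proof (intro conjI ballI)
  have WL: "W \<subseteq> continuous_linear_operators" using W openin_S_topology by blast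
  then show "(\<lambda>A x. T x + A x) ` W \<subseteq> continuous_linear_operators"
    using T add_continuous_linear_operators by blast
  fix S assume "S \<in> (\<lambda>A x. T x + A x) ` W"
  then obtain A where A: "A \<in> W" "S = (\<lambda>x. T x + A x)" by blast
  have "\<forall>A\<in>W. \<exists>B\<in>S_base \<S>. (\<lambda>C x. A x + C x) ` B \<subseteq> W"
    using W unfolding openin_S_topology by (rule conjunct2)
  then obtain B where B: "B \<in> S_base \<S>" "(\<lambda>C x. A x + C x) ` B \<subseteq> W"
    using A(1) by blast
  have "(\<lambda>x. S x + C x) \<in> (\<lambda>A x. T x + A x) ` W" if "C \<in> B" for C
  proof (rule image_eqI)
    show "(\<lambda>x. A x + C x) \<in> W" using B(2) that by blast
    show "(\<lambda>x. S x + C x) = (\<lambda>x. T x + (A x + C x))" by (simp add: A(2) add.assoc)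
  qed
  then show "\<exists>B\<in>S_base \<S>. (\<lambda>C x. S x + C x) ` B \<subseteq> (\<lambda>A x. T x + A x) ` W"
    using B(1) by blast
qed

text \<open>The singleton \<open>{K}\<close> with \<open>s \<in> K \<in> \<S>\<close> already gives a basic neighbourhood that controls the
  value at \<open>s\<close>. At a point outside \<open>\<Union>\<S>\<close> this argument is not available.\<close>

lemma continuous_map_S_topology_eval:
  fixes \<S> :: "'x::topological_real_vector set set"
  assumes s: "s \<in> \<Union>\<S>"
  shows "continuous_map (S_topology \<S> :: ('x \<Rightarrow> 'y::topological_real_vector) topology)
    euclidean (\<lambda>T. T s)"
  unfolding continuous_map
proof (intro conjI allI impI)
  fix O' :: "'y set" assume "openin euclidean O'"
  then have O': "open O'" by simp
  show "openin (S_topology \<S>) {T \<in> topspace (S_topology \<S>). T s \<in> O'}"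
    unfolding openin_S_topology topspace_S_topology
  proof (intro conjI ballI)
    fix T :: "'x \<Rightarrow> 'y"
    assume T: "T \<in> {T \<in> continuous_linear_operators. T s \<in> O'}"
    obtain K where K: "K \<in> \<S>" "s \<in> K" using s by blast
    let ?U = "(\<lambda>y. T s + y) -` O'"
    let ?B = "{A \<in> continuous_linear_operators. A ` \<Union>{K} \<subseteq> ?U}"
    have "?B \<in> S_base \<S>"
      using K T O' by (intro S_baseI open_vimage continuous_intros) auto
    moreover have "(\<lambda>A x. T x + A x) ` ?B \<subseteq> {T \<in> continuous_linear_operators. T s \<in> O'}"
      using K(2) T add_continuous_linear_operators by auto
    ultimately show "\<exists>B\<in>S_base \<S>. (\<lambda>A x. T x + A x) ` B \<subseteq> {T \<in> continuous_linear_operators. T s \<in> O'}"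
      by (rule bexI[rotated])
  qed auto
qed auto

lemma Hausdorff_space_S_topology:
  fixes \<S> :: "'x::topological_real_vector set set"
  assumes dense: "closure (\<Union>\<S>) = UNIV"
  shows "Hausdorff_space (S_topology \<S> :: ('x \<Rightarrow> 'y::{topological_real_vector, t2_space}) topology)"
  unfolding Hausdorff_space_def
proof (intro allI impI)
  fix S T :: "'x \<Rightarrow> 'y"
  let ?Z = "S_topology \<S> :: ('x \<Rightarrow> 'y) topology"
  assume ST: "S \<in> topspace ?Z \<and> T \<in> topspace ?Z \<and> S \<noteq> T"
  then have "S \<in> continuous_linear_operators" "T \<in> continuous_linear_operators" "S \<noteq> T" by auto
  with continuous_linear_operators_eqI[OF this(1,2) dense]
  obtain s where s: "s \<in> \<Union>\<S>" "S s \<noteq> T s" by blast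
  obtain U V where UV: "open U" "open V" "S s \<in> U" "T s \<in> V" "U \<inter> V = {}"
    using hausdorff[OF s(2)] by blast
  have "openin ?Z {A \<in> topspace ?Z. A s \<in> W}" if "open W" for W
    by (rule openin_continuous_map_preimage[OF continuous_map_S_topology_eval[OF s(1)]]) (use that in simp)
  then show "\<exists>U V. openin ?Z U \<and> openin ?Z V \<and> S \<in> U \<and> T \<in> V \<and> disjnt U V"
    using UV ST by (intro exI[of _ "{A \<in> topspace ?Z. A s \<in> U}"] exI[of _ "{A \<in> topspace ?Z. A s \<in> V}"])
      (auto simp: disjnt_iff)
qed

text \<open>Shrink the neighbourhood \<open>U\<close> of the origin of \<open>Y\<close> to a closed one, \<open>C\<close>. The operators that differ
  from \<open>T\<close> by values in \<open>C\<close> on \<open>\<Union>\<F>\<close> form a closed set, as evaluations at points of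
  \<open>\<Union>\<S>\<close> are continuous.\<close>

lemma regular_space_S_topology:
  fixes \<S> :: "'x::topological_real_vector set set"
  assumes \<S>: "\<And>K. K \<in> \<S> \<Longrightarrow> compact K"
    and reg: "regular_space (euclidean :: 'y::topological_real_vector topology)"
  shows "regular_space (S_topology \<S> :: ('x \<Rightarrow> 'y) topology)"
  unfolding neighbourhood_base_of_closedin[symmetric] neighbourhood_base_of
proof (intro allI impI)
  let ?Z = "S_topology \<S> :: ('x \<Rightarrow> 'y) topology"
  fix W and T :: "'x \<Rightarrow> 'y"
  assume W: "openin ?Z W \<and> T \<in> W"
  have TL: "T \<in> continuous_linear_operators" using W openin_S_topology by blast
  have "\<exists>B\<in>S_base \<S>. (\<lambda>A x. T x + A x) ` B \<subseteq> W"
    using W unfolding openin_S_topology by simp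
  then obtain \<F> U where \<F>: "finite \<F>" "\<F> \<subseteq> \<S>" and U: "open U" "0 \<in> U"
    and BW: "(\<lambda>A x. T x + A x) ` {A \<in> continuous_linear_operators. A ` \<Union>\<F> \<subseteq> U} \<subseteq> W"
    unfolding S_base_def by (elim bexE CollectE exE conjE) simp
  obtain V C where V: "open V" "closed C" "0 \<in> V" "V \<subseteq> C" "C \<subseteq> U"
    using regular_closed_neighbourhood[OF reg U] .
  let ?B = "{A \<in> continuous_linear_operators. A ` \<Union>\<F> \<subseteq> V} :: ('x \<Rightarrow> 'y) set"
  let ?O = "(\<lambda>A x. T x + A x) ` ?B"
  let ?C = "{A \<in> topspace ?Z. \<forall>x\<in>\<Union>\<F>. A x - T x \<in> C}"
  have "openin ?Z ?O"
    by (intro openin_S_topology_translation openin_S_base[OF \<S>] S_baseI \<F> V TL)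
  moreover have "closedin ?Z ?C"
  proof -
    have "closedin ?Z {A \<in> topspace ?Z. A x \<in> (\<lambda>y. y - T x) -` C}" if "x \<in> \<Union>\<F>" for x
    proof (rule closedin_continuous_map_preimage[OF continuous_map_S_topology_eval])
      show "x \<in> \<Union>\<S>" using that \<F>(2) by blast
      have "closed ((\<lambda>y. y - T x) -` C)"
        using V(2) by (intro closed_vimage continuous_intros)
      then show "closedin euclidean ((\<lambda>y. y - T x) -` C)" by simp
    qed
    then have "closedin ?Z (\<Inter>(insert (topspace ?Z) ((\<lambda>x. {A \<in> topspace ?Z. A x \<in> (\<lambda>y. y - T x) -` C}) ` \<Union>\<F>)))"
      using closedin_topspace[of ?Z] by (intro closedin_Inter) auto
    also have "\<Inter>(insert (topspace ?Z) ((\<lambda>x. {A \<in> topspace ?Z. A x \<in> (\<lambda>y. y - T x) -` C}) ` \<Union>\<F>)) = ?C"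
      by auto
    finally show ?thesis .
  qed
  moreover have "T \<in> ?O"
  proof (rule image_eqI)
    show "(\<lambda>x. 0) \<in> ?B"
      using V(3) by (auto simp: continuous_linear_operators_def linear_iff)
  qed auto
  moreover have "?O \<subseteq> ?C"
    using V(4) TL by (auto simp: image_subset_iff intro!: add_continuous_linear_operators)
  moreover have "?C \<subseteq> W"
  proof
    fix A assume A: "A \<in> ?C"
    show "A \<in> W"
    proof (rule subsetD[OF BW], rule image_eqI)
      show "A = (\<lambda>x. T x + (A x - T x))" by (simp add: fun_eq_iff)
      show "(\<lambda>x. A x - T x) \<in> {A \<in> continuous_linear_operators. A ` \<Union>\<F> \<subseteq> U}"
        using A V(5) TL by (auto intro!: diff_continuous_linear_operators)
    qed
  qed
  ultimately show "\<exists>U V. openin ?Z U \<and> closedin ?Z V \<and> T \<in> U \<and> U \<subseteq> V \<and> V \<subseteq> W"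
    by (intro exI[of _ ?O] exI[of _ ?C] conjI)
qed

lemma limitin_S_topologyI:
  fixes w :: "'i \<Rightarrow> 'x::topological_real_vector \<Rightarrow> 'y::topological_real_vector"
  assumes w: "\<And>m. w m \<in> continuous_linear_operators" and T: "T \<in> continuous_linear_operators"
    and unif: "\<And>K U. K \<in> \<S> \<Longrightarrow> open U \<Longrightarrow> 0 \<in> U \<Longrightarrow> \<forall>\<^sub>F m in F. \<forall>x\<in>K. w m x - T x \<in> U"
  shows "limitin (S_topology \<S>) w T F"
  unfolding limitin_def topspace_S_topology
proof (intro conjI allI impI T)
  fix W assume W: "openin (S_topology \<S>) W \<and> T \<in> W"
  then have "\<exists>B\<in>S_base \<S>. (\<lambda>A x. T x + A x) ` B \<subseteq> W"
    unfolding openin_S_topology by simp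
  then obtain \<F> U where \<F>: "finite \<F>" "\<F> \<subseteq> \<S>" and U: "open U" "0 \<in> U"
    and BW: "(\<lambda>A x. T x + A x) ` {A \<in> continuous_linear_operators. A ` \<Union>\<F> \<subseteq> U} \<subseteq> W"
    unfolding S_base_def by (elim bexE CollectE exE conjE) simp
  have "\<forall>\<^sub>F m in F. \<forall>K\<in>\<F>. \<forall>x\<in>K. w m x - T x \<in> U"
    using \<F>(1) by (rule eventually_ball_finite) (use \<F>(2) U unif in blast)
  then show "\<forall>\<^sub>F m in F. w m \<in> W"
  proof (rule eventually_mono)
    fix m assume m: "\<forall>K\<in>\<F>. \<forall>x\<in>K. w m x - T x \<in> U"
    show "w m \<in> W"
    proof (rule subsetD[OF BW], rule image_eqI)
      show "w m = (\<lambda>x. T x + (w m x - T x))" by (simp add: fun_eq_iff)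
      show "(\<lambda>x. w m x - T x) \<in> {A \<in> continuous_linear_operators. A ` \<Union>\<F> \<subseteq> U}"
        using m w T by (auto intro!: diff_continuous_linear_operators)
    qed
  qed
qed

text \<open>Distinct operators differ at a point \<open>e\<close> of the countable set \<open>E\<close>. The values at \<open>e\<close> of a compact set of
  operators form a compact set, which meets countably many members of the network of \<open>Y\<close>; their
  preimages under the evaluations at points of \<open>E\<close> form the countable separating family.\<close>

lemma S_topology_convergent_subsequence:
  fixes \<S> :: "'x::topological_real_vector set set" 
    and \<Q> :: "nat \<Rightarrow> 'y::{topological_real_vector, t2_space} set set"
    and K :: "('x \<Rightarrow> 'y) set"
  assumes reg: "regular_space (euclidean :: 'y topology)"
    and E: "countable E" "E \<subseteq> \<Union>\<S>" "closure E = UNIV"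
    and \<Q>: "closed_k_network \<Q>"
    and K: "compactin (S_topology \<S>) K" and s: "range s \<subseteq> K"
  shows "\<exists>(r :: nat \<Rightarrow> nat) l. strict_mono r \<and> limitin (S_topology \<S>) (s \<circ> r) l sequentially"
proof -
  interpret \<Q>: closed_k_network \<Q> by fact
  let ?Z = "S_topology \<S> :: ('x \<Rightarrow> 'y) topology"
  have KL: "K \<subseteq> topspace ?Z" using K by (rule compactin_subset_topspace)
  have cont: "continuous_map ?Z euclidean (\<lambda>T. T e)" if "e \<in> E" for e
    using E(2) that by (intro continuous_map_S_topology_eval) blast
  have cK: "compact ((\<lambda>T. T e) ` K)" if "e \<in> E" for e
    using image_compactin[OF K cont[OF that]] by simp
  define \<R> where "\<R> e = {Q \<in> (\<Union>n. \<Q> n). Q \<inter> (\<lambda>T. T e) ` K \<noteq> {}}" for e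
  define pull where "pull e Q = {T \<in> topspace ?Z. T e \<in> Q}" for e Q
  have cR: "countable (\<R> e)" if "e \<in> E" for e
  proof -
    have "finite {Q \<in> \<Q> n. Q \<inter> (\<lambda>T. T e) ` K \<noteq> {}}" for n
    proof (rule locally_finite_meets_finitely_many[OF \<Q>.locally_finite])
      fix t :: "nat \<Rightarrow> 'y" assume "range t \<subseteq> (\<lambda>T. T e) ` K"
      then show "\<exists>l. \<forall>U. open U \<and> l \<in> U \<longrightarrow> (\<exists>\<^sub>F i in sequentially. t i \<in> U)"
        using compactin_imp_cluster_point[of euclidean "(\<lambda>T. T e) ` K" t] cK[OF that] by auto
    qed
    then have "countable (\<Union>n. {Q \<in> \<Q> n. Q \<inter> (\<lambda>T. T e) ` K \<noteq> {}})"
      by (intro countable_UN) (auto intro: countable_finite)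
    moreover have "\<R> e = (\<Union>n. {Q \<in> \<Q> n. Q \<inter> (\<lambda>T. T e) ` K \<noteq> {}})"
      by (auto simp: \<R>_def)
    ultimately show ?thesis by simp
  qed
  show ?thesis
  proof (rule compactin_imp_convergent_subsequence[where K = K and \<A> = "\<Union>e\<in>E. pull e ` \<R> e"])
    show "compactin ?Z K" "range s \<subseteq> K" by fact+
    show "countable (\<Union>e\<in>E. pull e ` \<R> e)" using E(1) cR by auto
    fix S T assume ST: "S \<in> K" "T \<in> K" "S \<noteq> T"
    then have "S \<in> continuous_linear_operators" "T \<in> continuous_linear_operators"
      using KL by auto
    from continuous_linear_operators_eqI[OF this E(3)] ST(3)
    obtain e where e: "e \<in> E" "S e \<noteq> T e" by blast
    have net': "\<exists>\<F>\<subseteq>(\<Union>n. \<Q> n). finite \<F> \<and> C \<subseteq> \<Union>\<F> \<and> \<Union>\<F> \<subseteq> U"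
      if CU: "compact C" "open U" "C \<subseteq> U" for C U
    proof -
      from \<Q>.net[OF CU] obtain n \<F> where "\<F> \<subseteq> \<Q> n" "finite \<F>" "C \<subseteq> \<Union>\<F>" "\<Union>\<F> \<subseteq> U"
        by (elim exE conjE)
      then show ?thesis by (intro exI[of _ \<F>]) auto
    qed
    from k_network_separates_points[OF reg cK[OF e(1)] net' e(2)]
    obtain U V \<F> where UV: "open U" "open V" "S e \<in> U" "T e \<in> V" "finite \<F>" "\<F> \<subseteq> \<R> e"
      "U \<inter> (\<lambda>T. T e) ` K \<subseteq> \<Union>\<F>" "V \<inter> \<Union>\<F> = {}"
      unfolding \<R>_def .
    have op: "openin ?Z (pull e W)" if "open W" for W
      unfolding pull_def
      by (rule openin_continuous_map_preimage[OF cont[OF e(1)]]) (use that in simp)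
    show "\<exists>U V \<G>. openin ?Z U \<and> openin ?Z V \<and> S \<in> U \<and> T \<in> V \<and> finite \<G> \<and>
        \<G> \<subseteq> (\<Union>e\<in>E. pull e ` \<R> e) \<and> U \<inter> K \<subseteq> \<Union>\<G> \<and> V \<inter> K \<inter> \<Union>\<G> = {}"
    proof (intro exI conjI)
      show "openin ?Z (pull e U)" "openin ?Z (pull e V)" using op UV by auto
      show "S \<in> pull e U" "T \<in> pull e V" using ST KL UV by (auto simp: pull_def)
      show "finite (pull e ` \<F>)" using UV(5) by simp
      show "pull e ` \<F> \<subseteq> (\<Union>e\<in>E. pull e ` \<R> e)" using UV(6) e(1) by blast
      show "pull e U \<inter> K \<subseteq> \<Union>(pull e ` \<F>)" using UV(7) by (auto simp: pull_def)
      show "pull e V \<inter> K \<inter> \<Union>(pull e ` \<F>) = {}" using UV(8) by (auto simp: pull_def)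
    qed
  qed
qed

section \<open>Labels of functions\<close>

text \<open>Suppose no \<open>P\<close> and \<open>n\<close> work. Along a decreasing sequence of members of \<open>\<P>\<close> shrinking to \<open>x\<close> one can
  then pick points tending to \<open>x\<close> whose images avoid, at stage \<open>n\<close>, the members of \<open>\<Q> n\<close> inside \<open>U\<close>
  containing \<open>y\<close>. But the images tend to \<open>y\<close>, so some member of the \<open>k\<close>-network inside \<open>U\<close> contains
  infinitely many of them, and being closed it contains \<open>y\<close>: a contradiction at late stages.\<close>

lemma convergent_functions_trapped:
  fixes z :: "nat \<Rightarrow> 'x::topological_space \<Rightarrow> 'y::topological_space"
    and \<Q> :: "nat \<Rightarrow> 'y set set"
  assumes \<P>: "countable_cs_network \<P>" and \<Q>: "closed_k_network \<Q>" and a: "a \<longlonglongrightarrow> x"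
    and conv: "\<And>r s. strict_mono r \<Longrightarrow> s \<longlonglongrightarrow> x \<Longrightarrow> (\<lambda>i. z (r i) (s i)) \<longlonglongrightarrow> y"
    and U: "open U" "y \<in> U"
  shows "\<exists>P\<in>\<P>. \<exists>n. x \<in> P \<and> (\<forall>\<^sub>F m in sequentially. a m \<in> P) \<and>
    (\<forall>\<^sub>F m in sequentially. z m ` P \<subseteq> \<Union>{Q \<in> \<Q> n. Q \<subseteq> U \<and> y \<in> Q})"
proof -
  interpret \<P>: countable_cs_network \<P> by fact
  interpret \<Q>: closed_k_network \<Q> by fact
  define \<C> where "\<C> = {P \<in> \<P>. x \<in> P \<and> (\<forall>\<^sub>F m in sequentially. a m \<in> P)}"
  have "countable \<C>" "\<C> \<noteq> {}"
    using \<P>.countable \<P>.cs[OF a, of UNIV] by (auto simp: \<C>_def)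
  then have C: "range (from_nat_into \<C>) = \<C>" by simp
  \<comment> \<open>The decreasing sequence of members of \<open>\<P>\<close> that shrinks to \<open>x\<close>.\<close>
  define D where "D n = (\<Inter>i\<le>n. from_nat_into \<C> i)" for n
  have D: "D n \<in> \<C>" for n
  proof (induction n)
    case 0
    then show ?case using C by (auto simp: D_def)
  next
    case (Suc n)
    have "from_nat_into \<C> (Suc n) \<in> \<C>" using C by auto
    moreover have "D (Suc n) = from_nat_into \<C> (Suc n) \<inter> D n"
      by (simp add: D_def atMost_Suc)
    ultimately show ?case
      using Suc \<P>.Int by (auto simp: \<C>_def intro: eventually_conj)
  qed
  define G where "G n = \<Union>{Q \<in> \<Q> n. Q \<subseteq> U \<and> y \<in> Q}" for n
  have "\<exists>n. \<forall>\<^sub>F m in sequentially. z m ` D n \<subseteq> G n"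
  proof (rule ccontr)
    assume "\<not> ?thesis"
    then have ex: "\<exists>m\<ge>N. \<not> z m ` D n \<subseteq> G n" for n N
      unfolding eventually_sequentially by blast
    have "\<exists>r. \<forall>n. \<not> z (r n) ` D n \<subseteq> G n \<and> r n < r (Suc n)"
    proof (rule dependent_nat_choice)
      show "\<exists>m. \<not> z m ` D 0 \<subseteq> G 0" using ex[of 0 0] by blast
      show "\<exists>m. \<not> z m ` D (Suc n) \<subseteq> G (Suc n) \<and> l < m" for l n
        using ex[of "Suc l" "Suc n"] by (metis Suc_le_eq)
    qed
    then obtain r where r: "\<And>n. \<not> z (r n) ` D n \<subseteq> G n" "\<And>n. r n < r (Suc n)" by blast
    then have sr: "strict_mono r" by (simp add: strict_mono_Suc_iff)
    have "\<forall>n. \<exists>p. p \<in> D n \<and> z (r n) p \<notin> G n" using r(1) by (simp add: image_subset_iff) blast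
    then obtain s where s: "\<And>n. s n \<in> D n" "\<And>n. z (r n) (s n) \<notin> G n" by metis
    have "s \<longlonglongrightarrow> x"
    proof (rule topological_tendstoI)
      fix V assume "open V" "x \<in> V"
      then obtain P where "P \<in> \<C>" "P \<subseteq> V" using \<P>.cs[OF a, of V] by (auto simp: \<C>_def)
      then obtain i where i: "from_nat_into \<C> i \<subseteq> V" using C by (metis imageE)
      have "s n \<in> V" if "n \<ge> i" for n
        using s(1)[of n] i that by (auto simp: D_def)
      then show "\<forall>\<^sub>F n in sequentially. s n \<in> V" by (auto simp: eventually_sequentially)
    qed
    then have lim: "(\<lambda>n. z (r n) (s n)) \<longlonglongrightarrow> y" by (rule conv[OF sr])
    then obtain N where N: "\<And>n. n \<ge> N \<Longrightarrow> z (r n) (s n) \<in> U"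
      using topological_tendstoD[OF lim U] by (auto simp: eventually_sequentially)
    let ?t = "\<lambda>n. z (r (n + N)) (s (n + N))"
    have t: "?t \<longlonglongrightarrow> y" using LIMSEQ_ignore_initial_segment[OF lim, of N] .
    have "insert y (range ?t) \<subseteq> U" using N U(2) by auto
    from \<Q>.net[OF compact_insert_limit_range[OF t] U(1) this]
    obtain k \<F> where \<F>: "\<F> \<subseteq> \<Q> k" "finite \<F>" "insert y (range ?t) \<subseteq> \<Union>\<F>" "\<Union>\<F> \<subseteq> U"
      by (elim exE conjE)
    have "\<exists>\<^sub>F n in sequentially. \<exists>Q\<in>\<F>. ?t n \<in> Q"
    proof (rule eventually_frequently)
      have "?t n \<in> \<Union>\<F>" for n using \<F>(3) by blast
      then show "\<forall>\<^sub>F n in sequentially. \<exists>Q\<in>\<F>. ?t n \<in> Q" by (simp add: Bex_def)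
    qed simp
    from frequently_bex_finite[OF \<F>(2) this]
    obtain Q where Q: "Q \<in> \<F>" "\<exists>\<^sub>F n in sequentially. ?t n \<in> Q" by blast
    have Qk: "Q \<in> \<Q> k" "Q \<subseteq> U" using Q(1) \<F>(1,4) by auto
    have "y \<in> Q"
    proof (rule ccontr)
      assume "y \<notin> Q"
      then have "\<forall>\<^sub>F n in sequentially. ?t n \<in> - Q"
        using topological_tendstoD[OF t, of "- Q"] \<Q>.closed[OF Qk(1)] by auto
      then show False using Q(2) by (simp add: frequently_def)
    qed
    obtain n where n: "n \<ge> k" "?t n \<in> Q"
      using Q(2) by (auto simp: frequently_sequentially)
    then have "Q \<in> \<Q> (n + N)" using Qk(1) monoD[OF \<Q>.mono, of k "n + N"] by auto
    then have "?t n \<in> G (n + N)" using n(2) Qk(2) \<open>y \<in> Q\<close> by (auto simp: G_def)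
    then show False using s(2) by blast
  qed
  then obtain n where "\<forall>\<^sub>F m in sequentially. z m ` D n \<subseteq> G n" by blast
  then show ?thesis
    using D[of n] by (intro bexI[of _ "D n"] exI[of _ n]) (simp_all add: \<C>_def G_def)
qed

text \<open>The members of \<open>\<A>\<close> linked to \<open>y\<close> by a set \<open>R\<close>. The finiteness condition on \<open>R\<close> is what makes the
  linked members of a whole compact set of values finite in number.\<close>

definition near_members :: "'y set set \<Rightarrow> 'y set set \<Rightarrow> 'y \<Rightarrow> 'y set set" where
  "near_members \<A> \<R> y =
     {Q \<in> \<A>. \<exists>R\<in>\<R>. y \<in> R \<and> R \<inter> Q \<noteq> {} \<and> finite {Q' \<in> \<A>. Q' \<inter> R \<noteq> {}}}"

text \<open>For nonempty \<open>P\<close> the choice picks a point of \<open>P\<close> that is the same for all functions \<open>g\<close>, so that the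
  admissible covers of \<open>g(P)\<close> are governed by the values of the functions at a single point.\<close>

definition covers_label ::
    "'y set set \<Rightarrow> 'y set set \<Rightarrow> 'x set \<Rightarrow> ('x \<Rightarrow> 'y) \<Rightarrow> 'y set set set" where
  "covers_label \<A> \<R> P g = {\<F>. \<F> \<subseteq> near_members \<A> \<R> (g (SOME p. p \<in> P)) \<and> g ` P \<subseteq> \<Union>\<F>}"

lemma finite_covers_label:
  assumes "finite {R \<in> \<R>. R \<inter> (\<lambda>g. g (SOME p. p \<in> P)) ` K \<noteq> {}}"
  shows "finite (covers_label \<A> \<R> P ` K)"
proof -
  let ?R = "{R \<in> \<R>. R \<inter> (\<lambda>g. g (SOME p. p \<in> P)) ` K \<noteq> {} \<and> finite {Q \<in> \<A>. Q \<inter> R \<noteq> {}}}"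
  let ?N = "\<Union>R\<in>?R. {Q \<in> \<A>. Q \<inter> R \<noteq> {}}"
  have "finite ?R" by (rule finite_subset[OF _ assms]) auto
  then have N: "finite ?N" by (rule finite_UN_I) auto
  have "near_members \<A> \<R> (g (SOME p. p \<in> P)) \<subseteq> ?N" if "g \<in> K" for g
    using that unfolding near_members_def by blast
  then have "covers_label \<A> \<R> P ` K \<subseteq> Pow (Pow ?N)"
    unfolding covers_label_def by blast
  then show ?thesis by (rule finite_subset) (use N in simp)
qed

text \<open>Trap the functions \<open>z m\<close> twice: first on \<open>P1\<close> inside the given neighbourhood \<open>U\<close> of \<open>y\<close> by members of
  \<open>\<Q> n\<close>, then on \<open>P2\<close> inside a neighbourhood \<open>V\<close> of \<open>y\<close> meeting finitely many members of \<open>\<Q> n\<close>. On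
  \<open>P1 \<inter> P2\<close> the trapping members of \<open>\<Q> n\<close> contain \<open>y\<close>, and so does the member \<open>R \<subseteq> V\<close> containing the value
  at the chosen point; hence they are linked to that value and the cover occurs in the label of
  \<open>z m\<close>. It then occurs in the label of \<open>w m\<close>, which puts \<open>w m (a m)\<close> into \<open>U\<close>.\<close>

lemma equal_labels_imp_same_limit:
  fixes z w :: "nat \<Rightarrow> 'x::topological_space \<Rightarrow> 'y::topological_space"
    and \<Q> :: "nat \<Rightarrow> 'y set set"
  assumes \<P>: "countable_cs_network \<P>" and \<Q>: "closed_k_network \<Q>" and a: "a \<longlonglongrightarrow> x"
    and conv: "\<And>r s. strict_mono r \<Longrightarrow> s \<longlonglongrightarrow> x \<Longrightarrow> (\<lambda>i. z (r i) (s i)) \<longlonglongrightarrow> y"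
    and labels: "\<And>P n k. P \<in> \<P> \<Longrightarrow> \<forall>\<^sub>F m in sequentially.
      covers_label (\<Q> n) (\<Q> k) P (w m) = covers_label (\<Q> n) (\<Q> k) P (z m)"
  shows "(\<lambda>m. w m (a m)) \<longlonglongrightarrow> y"
proof (rule topological_tendstoI)
  fix U assume U: "open U" "y \<in> U"
  interpret \<P>: countable_cs_network \<P> by fact
  interpret \<Q>: closed_k_network \<Q> by fact
  have trap: "\<exists>P\<in>\<P>. \<exists>n. x \<in> P \<and> (\<forall>\<^sub>F m in sequentially. a m \<in> P) \<and>
      (\<forall>\<^sub>F m in sequentially. z m ` P \<subseteq> \<Union>{Q \<in> \<Q> n. Q \<subseteq> W \<and> y \<in> Q})"
    if "open W" "y \<in> W" for W
    by (rule convergent_functions_trapped[OF \<P> \<Q> a, where z = z]) (fact conv that)+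
  obtain P1 n where 1: "P1 \<in> \<P>" "x \<in> P1" "\<forall>\<^sub>F m in sequentially. a m \<in> P1"
    "\<forall>\<^sub>F m in sequentially. z m ` P1 \<subseteq> \<Union>{Q \<in> \<Q> n. Q \<subseteq> U \<and> y \<in> Q}"
    using trap[OF U] by (elim bexE exE conjE)
  obtain V where V: "open V" "y \<in> V" "finite {Q \<in> \<Q> n. Q \<inter> V \<noteq> {}}" using \<Q>.locally_finite by blast
  obtain P2 k where 2: "P2 \<in> \<P>" "x \<in> P2" "\<forall>\<^sub>F m in sequentially. a m \<in> P2"
    "\<forall>\<^sub>F m in sequentially. z m ` P2 \<subseteq> \<Union>{Q \<in> \<Q> k. Q \<subseteq> V \<and> y \<in> Q}"
    using trap[OF V(1,2)] by (elim bexE exE conjE)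
  define P where "P = P1 \<inter> P2"
  let ?F = "{Q \<in> \<Q> n. Q \<subseteq> U \<and> y \<in> Q}"
  have P: "P \<in> \<P>" unfolding P_def using 1(1) 2(1) by (rule \<P>.Int)
  have "\<exists>p. p \<in> P" using 1(2) 2(2) by (auto simp: P_def)
  then have p: "(SOME p. p \<in> P) \<in> P" by (rule someI_ex)
  have "\<forall>\<^sub>F m in sequentially. ?F \<in> covers_label (\<Q> n) (\<Q> k) P (z m)"
    using 1(4) 2(4)
  proof eventually_elim
    case (elim m)
    have "z m (SOME p. p \<in> P) \<in> \<Union>{Q \<in> \<Q> k. Q \<subseteq> V \<and> y \<in> Q}"
      using elim(2) p by (auto simp: P_def)
    then obtain R where R: "R \<in> \<Q> k" "R \<subseteq> V" "y \<in> R" "z m (SOME p. p \<in> P) \<in> R" by blast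
    have "finite {Q \<in> \<Q> n. Q \<inter> R \<noteq> {}}"
      by (rule finite_subset[OF _ V(3)]) (use R(2) in blast)
    then have "?F \<subseteq> near_members (\<Q> n) (\<Q> k) (z m (SOME p. p \<in> P))"
      unfolding near_members_def using R by blast
    moreover have "z m ` P \<subseteq> \<Union>?F" using elim(1) by (auto simp: P_def)
    ultimately show ?case unfolding covers_label_def by simp
  qed
  then show "\<forall>\<^sub>F m in sequentially. w m (a m) \<in> U"
    using labels[OF P, of n k] 1(3) 2(3)
  proof eventually_elim
    case (elim m)
    then have "?F \<in> covers_label (\<Q> n) (\<Q> k) P (w m)" by metis
    then have "w m ` P \<subseteq> \<Union>?F" unfolding covers_label_def by simp
    moreover have "a m \<in> P" using elim by (simp add: P_def)
    ultimately show ?case by blast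
  qed
qed

section \<open>Operator spaces\<close>

theorem theorem11p2:
  fixes \<S> :: "'x::{topological_real_vector, t2_space} set set"
  assumes "aleph0_space (euclidean :: 'x topology)"
    and "\<And>K. K \<in> \<S> \<Longrightarrow> compact K"
    and "closure (\<Union>\<S>) = UNIV"
    and "aleph_space (euclidean :: 'y::{topological_real_vector, t2_space} topology)"
    and "sequentially_continuous_map
           (prod_topology (S_topology \<S> :: ('x \<Rightarrow> 'y) topology) (euclidean :: 'x topology))
           (euclidean :: 'y topology) (\<lambda>(T, x). T x)"
  shows "k_star_metrizable (S_topology \<S> :: ('x \<Rightarrow> 'y) topology)"
proof -
  let ?Z = "S_topology \<S> :: ('x \<Rightarrow> 'y) topology"
  obtain \<N> :: "'x set set" where regX: "regular_space (euclidean :: 'x topology)"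
    and \<N>: "countable \<N>" "k_network euclidean \<N>"
    using assms(1) by (auto simp: aleph0_space_def)
  obtain \<M> :: "'y set set" where hausY: "Hausdorff_space (euclidean :: 'y topology)" and regY: "regular_space (euclidean :: 'y topology)"
    and \<M>: "sigma_locally_finite_in euclidean \<M>" "k_network euclidean \<M>"
    using assms(4) by (auto simp: aleph_space_def)
  obtain \<P> :: "'x set set" where \<P>: "countable_cs_network \<P>"
    by (rule countable_k_network_imp_countable_cs_network[OF \<N>])
  then interpret \<P>: countable_cs_network \<P> .
  obtain \<Q> :: "nat \<Rightarrow> 'y set set" where \<Q>: "closed_k_network \<Q>"
    by (rule sigma_locally_finite_k_network_closed[OF regY \<M>])
  then interpret \<Q>: closed_k_network \<Q> .
  have "\<exists>P\<in>\<P>. x \<in> P \<and> P \<subseteq> U" if "open U" "x \<in> U" for x U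
    using \<P>.cs[OF tendsto_const that] by blast
  from countable_network_dense_subset[OF \<P>.countable this, of "\<Union>\<S>"]
  obtain E where E: "countable E" "E \<subseteq> \<Union>\<S>" "closure E = UNIV"
    unfolding assms(3) .
  note subseq = S_topology_convergent_subsequence[OF regY E \<Q>]
  have eval: "(\<lambda>i. T i (s i)) \<longlonglongrightarrow> S x"
    if T: "limitin ?Z T S sequentially" "range T \<subseteq> topspace ?Z" and s: "s \<longlonglongrightarrow> x" for T S s x
  proof -
    have "limitin (prod_topology ?Z euclidean) (\<lambda>i. (T i, s i)) (S, x) sequentially"
      using T(1) s by (simp add: limitin_pairwise o_def)
    moreover have "range (\<lambda>i. (T i, s i)) \<subseteq> topspace (prod_topology ?Z (euclidean :: 'x topology))"
      using T(2) by auto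
    ultimately have "limitin euclidean ((\<lambda>(T, x). T x) \<circ> (\<lambda>i. (T i, s i))) ((\<lambda>(T, x). T x) (S, x)) sequentially"
      by (intro sequentially_continuous_map_limit[OF assms(5) hausY])
    then show ?thesis by (simp add: o_def)
  qed
  define \<phi> :: "nat \<Rightarrow> ('x \<Rightarrow> 'y) \<Rightarrow> 'y set set set"
    where "\<phi> i = (case from_nat i of (j, n, k) \<Rightarrow> covers_label (\<Q> n) (\<Q> k) (from_nat_into \<P> j))" for i
  show ?thesis
  proof (rule k_star_metrizable_by_labels[of ?Z \<phi>])
    show "Hausdorff_space ?Z" by (rule Hausdorff_space_S_topology[OF assms(3)])
    show "regular_space ?Z" by (rule regular_space_S_topology[OF assms(2) regY])
    show "\<exists>(r :: nat \<Rightarrow> nat) l. strict_mono r \<and> limitin ?Z (s \<circ> r) l sequentially"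
      if "compactin ?Z K" "range s \<subseteq> K" for K s
      using that by (rule subseq)
    show "finite (\<phi> i ` K)" if K: "compactin ?Z K" for K i
    proof -
      obtain j n k :: nat where i: "from_nat i = (j, n, k)" by (metis prod_cases3)
      let ?p = "SOME p. p \<in> from_nat_into \<P> j"
      \<comment> \<open>The point \<open>?p\<close> may lie outside \<open>\<Union>\<S>\<close>, so \<open>(\<lambda>g. g ?p) ` K\<close> is not known to be compact;
        convergent subsequences in \<open>K\<close> replace compactness.\<close>
      have "finite {R \<in> \<Q> k. R \<inter> (\<lambda>g. g ?p) ` K \<noteq> {}}"
      proof (rule locally_finite_meets_finitely_many[OF \<Q>.locally_finite])
        fix t :: "nat \<Rightarrow> 'y" assume "range t \<subseteq> (\<lambda>g. g ?p) ` K"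
        then have "\<forall>i. \<exists>g. g \<in> K \<and> t i = g ?p" by blast
        then obtain g where g: "\<And>i. g i \<in> K" "\<And>i. t i = g i ?p" by metis
        then have "range g \<subseteq> K" by blast
        with subseq[OF K] obtain r :: "nat \<Rightarrow> nat" and S
          where r: "strict_mono r" "limitin ?Z (g \<circ> r) S sequentially" by blast
        have "range (g \<circ> r) \<subseteq> topspace ?Z"
          using \<open>range g \<subseteq> K\<close> compactin_subset_topspace[OF K] by auto
        from eval[OF r(2) this tendsto_const[of ?p]]
        have lim: "(\<lambda>i. t (r i)) \<longlonglongrightarrow> S ?p" by (simp add: g(2))
        show "\<exists>l. \<forall>U. open U \<and> l \<in> U \<longrightarrow> (\<exists>\<^sub>F i in sequentially. t i \<in> U)"
        proof (intro exI allI impI)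
          fix U assume "open U \<and> S ?p \<in> U"
          then obtain N where N: "\<And>i. i \<ge> N \<Longrightarrow> t (r i) \<in> U"
            using topological_tendstoD[OF lim, of U] by (auto simp: eventually_sequentially)
          have "\<exists>i\<ge>M. t i \<in> U" for M
            using N[of "max M N"] seq_suble[OF r(1), of "max M N"]
            by (intro exI[of _ "r (max M N)"]) auto
          then show "\<exists>\<^sub>F i in sequentially. t i \<in> U"
            by (simp add: frequently_sequentially)
        qed
      qed
      then show ?thesis
        unfolding \<phi>_def i prod.case by (rule finite_covers_label)
    qed
    show "limitin ?Z w S sequentially"
      if z: "range z \<subseteq> topspace ?Z" and w: "range w \<subseteq> topspace ?Z"
        and zS: "limitin ?Z z S sequentially"
        and lab: "\<And>i. \<forall>\<^sub>F m in sequentially. \<phi> i (w m) = \<phi> i (z m)" for z w S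
    proof (rule limitin_S_topologyI)
      show wL: "w m \<in> continuous_linear_operators" for m using w by auto
      show SL: "S \<in> continuous_linear_operators" using limitin_topspace[OF zS] by simp
      have lab': "\<forall>\<^sub>F m in sequentially.
          covers_label (\<Q> n) (\<Q> k) P (w m) = covers_label (\<Q> n) (\<Q> k) P (z m)"
        if "P \<in> \<P>" for P n k
      proof -
        have "P \<in> range (from_nat_into \<P>)" using that \<P>.countable by (metis empty_iff range_from_nat_into)
        then obtain j where j: "P = from_nat_into \<P> j" by (rule imageE)
        show ?thesis using lab[of "to_nat (j, n, k)"] by (simp add: \<phi>_def j)
      qed
      fix K U assume K: "K \<in> \<S>" and U: "open U" "(0 :: 'y) \<in> U"
      show "\<forall>\<^sub>F m in sequentially. \<forall>x\<in>K. w m x - S x \<in> U"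
      proof (rule ccontr)
        assume "\<not> ?thesis"
        then have "infinite {m. \<not> (\<forall>x\<in>K. w m x - S x \<in> U)}"
          by (simp add: eventually_cofinite flip: cofinite_eq_sequentially)
        from infinite_enumerate[OF this] obtain q :: "nat \<Rightarrow> nat"
          where q: "strict_mono q" "\<And>m. \<exists>x\<in>K. w (q m) x - S x \<notin> U" by auto
        from q(2) obtain a where a: "\<And>m. a m \<in> K" "\<And>m. w (q m) (a m) - S (a m) \<notin> U" by metis
        \<comment> \<open>A failure of uniform convergence is witnessed along a convergent sequence of points of \<open>K\<close>.\<close>
        have "range a \<subseteq> K" using a(1) by blast
        from countable_k_network_convergent_subsequence[OF regX assms(2)[OF K] \<N> this]
        obtain r x where r: "strict_mono r" "(a \<circ> r) \<longlonglongrightarrow> x" .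
        define h where "h = q \<circ> r"
        have h: "strict_mono h" unfolding h_def using q(1) r(1) by (rule strict_mono_o)
        have "(\<lambda>m. w (h m) ((a \<circ> r) m)) \<longlonglongrightarrow> S x"
        proof (rule equal_labels_imp_same_limit[OF \<P> \<Q> r(2), where z = "\<lambda>m. z (h m)"])
          fix r' :: "nat \<Rightarrow> nat" and s
          assume r': "strict_mono r'" and s: "s \<longlonglongrightarrow> x"
          have "limitin ?Z (z \<circ> (h \<circ> r')) S sequentially"
            by (rule limitin_subsequence[OF strict_mono_o[OF h r'] zS])
          from eval[OF this _ s] show "(\<lambda>i. z (h (r' i)) (s i)) \<longlonglongrightarrow> S x"
            using z by auto
        next
          fix P n k assume "P \<in> \<P>"
          from eventually_subseq[OF h lab'[OF this]]
          show "\<forall>\<^sub>F m in sequentially.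
            covers_label (\<Q> n) (\<Q> k) P (w (h m)) = covers_label (\<Q> n) (\<Q> k) P (z (h m))" .
        qed
        moreover have "(\<lambda>m. S ((a \<circ> r) m)) \<longlonglongrightarrow> S x"
          using SL by (intro continuous_on_tendsto_compose[OF _ r(2)])
            (auto simp: continuous_linear_operators_def)
        ultimately have lim: "(\<lambda>m. w (h m) ((a \<circ> r) m) - S ((a \<circ> r) m)) \<longlonglongrightarrow> S x - S x"
          by (rule tendsto_diff)
        have "\<forall>\<^sub>F m in sequentially. w (h m) ((a \<circ> r) m) - S ((a \<circ> r) m) \<in> U"
          by (rule topological_tendstoD[OF lim U(1)]) (simp add: U(2))
        then show False using a(2) by (simp add: h_def)
      qed
    qed
  qed
qed

end
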